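(* For every integer $q\ge 4$, $d_{\rm abs}(K_q)\le q+0.5$.
   Context: A $K_q$-decomposition of a graph $G$ is a collection of pairwise edge-disjoint copies of $K_q$ in $G$ whose edge sets partition $E(G)$. A graph $G$ is $K_q$-divisible if $\binom q2\mid e(G)$ and $(q-1)\mid d(v)$ for every $v\in V(G)$. For a $K_q$-divisible graph $L$, a graph $A$ is a $K_q$-absorber for $L$ if $V(L)\subseteq V(A)$ is independent in $A$ and both $A$ and $L\cup A$ admit $K_q$-decompositions. For a graph $H$ and an independent set $R\subseteq V(H)$ of $H$, the maximum rooted density is $m(H,R):=\max\left\{\frac{e(H')}{|V(H')\setminus R|}: H'\subseteq H,\ V(H')\setminus R\neq\emptyset\right\}$. The maximum $2$-density is $m_2(H):=\max\left\{\frac{e(H')-1}{v(H')-2}: H'\subseteq H,\ v(H')\ge 3\right\}$, and the maximum rooted $2$-density is $m_2(H,R):=\max\{m(H,R),\,m_2(H)\}$. The $K_q$-absorber rooted $2$-density threshold $d_{\rm abs}(K_q)$ is the infimum over all positive reals $r$ such that for all positive integers $C_1$ there exists a positive integer $C_2$ such that for every $K_q$-divisible graph $L$ on at most $C_1$ vertices there exists a $K_q$-absorber $A$ of $L$ on at most $C_2$ vertices with $m_2(A,V(L))\le r$. *)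

theory Defs
  imports Complex_Main "HOL-Library.Extended_Real"
begin

record 'a graph =
  verts :: "'a set"
  edges :: "'a set set"

definition simple_graph :: "'a graph \<Rightarrow> bool" where
  "simple_graph G \<longleftrightarrow>
     finite (verts G) \<and> (\<forall>e\<in>edges G. e \<subseteq> verts G \<and> card e = 2)"

definition degree :: "'a graph \<Rightarrow> 'a \<Rightarrow> nat" where
  "degree G v = card {e \<in> edges G. v \<in> e}"

definition subgraph :: "'a graph \<Rightarrow> 'a graph \<Rightarrow> bool" where
  "subgraph H G \<longleftrightarrow>
     simple_graph H \<and> verts H \<subseteq> verts G \<and> edges H \<subseteq> edges G"

definition graph_union :: "'a graph \<Rightarrow> 'a graph \<Rightarrow> 'a graph" where
  "graph_union G H = \<lparr>verts = verts G \<union> verts H, edges = edges G \<union> edges H\<rparr>"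

definition independent_set :: "'a graph \<Rightarrow> 'a set \<Rightarrow> bool" where
  "independent_set G R \<longleftrightarrow> R \<subseteq> verts G \<and> (\<forall>u\<in>R. \<forall>v\<in>R. {u, v} \<notin> edges G)"

definition is_clique_copy :: "nat \<Rightarrow> 'a graph \<Rightarrow> bool" where
  "is_clique_copy q K \<longleftrightarrow>
     finite (verts K) \<and> card (verts K) = q \<and>
     edges K = {{u, v} | u v. u \<in> verts K \<and> v \<in> verts K \<and> u \<noteq> v}"

definition clique_decomposition :: "nat \<Rightarrow> 'a graph \<Rightarrow> 'a graph set \<Rightarrow> bool" where
  "clique_decomposition q G D \<longleftrightarrow>
     (\<forall>K\<in>D. is_clique_copy q K \<and> subgraph K G) \<and>
     pairwise (\<lambda>K K'. edges K \<inter> edges K' = {}) D \<and>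
     (\<Union>K\<in>D. edges K) = edges G"

definition clique_divisible :: "nat \<Rightarrow> 'a graph \<Rightarrow> bool" where
  "clique_divisible q G \<longleftrightarrow>
     (q choose 2) dvd card (edges G) \<and> (\<forall>v\<in>verts G. (q - 1) dvd degree G v)"

definition clique_absorber :: "nat \<Rightarrow> 'a graph \<Rightarrow> 'a graph \<Rightarrow> bool" where
  "clique_absorber q L A \<longleftrightarrow>
     simple_graph A \<and> independent_set A (verts L) \<and>
     (\<exists>D. clique_decomposition q A D) \<and>
     (\<exists>D. clique_decomposition q (graph_union L A) D)"

(* The maxima below range over an empty set only if H has no vertex outside R,
   respectively fewer than 3 vertices; the value 0 is used then.  Isolated vertices
   can always be added to an absorber without making its densities exceed a
   nonnegative bound, so the choice does not affect the threshold. *)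
definition max0 :: "real set \<Rightarrow> real" where
  "max0 S = (if S = {} then 0 else Max S)"

definition rooted_density :: "'a graph \<Rightarrow> 'a set \<Rightarrow> real" where
  "rooted_density H R =
     max0 {real (card (edges H')) / real (card (verts H' - R)) | H'.
             subgraph H' H \<and> verts H' - R \<noteq> {}}"

definition two_density :: "'a graph \<Rightarrow> real" where
  "two_density H =
     max0 {(real (card (edges H')) - 1) / (real (card (verts H')) - 2) | H'.
             subgraph H' H \<and> card (verts H') \<ge> 3}"

definition rooted_two_density :: "'a graph \<Rightarrow> 'a set \<Rightarrow> real" where
  "rooted_two_density H R = max (rooted_density H R) (two_density H)"

(* Every finite graph is isomorphic to one on a finite set of naturals, which leaves
   infinitely many vertices for an absorber.  The infimum is taken in the extended
   reals so that it is infinite if no r is admissible. *)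
definition d_abs :: "nat \<Rightarrow> ereal" where
  "d_abs q = Inf {ereal r | r :: real. r > 0 \<and>
     (\<forall>C1::nat. C1 > 0 \<longrightarrow> (\<exists>C2::nat. C2 > 0 \<and>
       (\<forall>L :: nat graph.
          simple_graph L \<and> clique_divisible q L \<and> card (verts L) \<le> C1 \<longrightarrow>
          (\<exists>A :: nat graph. clique_absorber q L A \<and> card (verts A) \<le> C2 \<and>
             rooted_two_density A (verts L) \<le> r))))}"

end

theory Submission
  imports Defs "HOL-Library.Disjoint_Sets"
begin

text \<open>
  The absorber of a \<open>K\<^sub>q\<close>-divisible graph \<open>L\<close> is assembled from one switch.  For distinct
  \<open>y\<close>, \<open>y'\<close> and a set \<open>U\<close> of \<open>q - 1\<close> vertices, take a grid of new vertices \<open>z u i\<close> with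
  \<open>u \<in> U\<close> and \<open>i < q - 2\<close>, make its rows and columns cliques, join the row of \<open>u\<close> to \<open>u\<close>, and
  join all of the grid to \<open>y\<close> and \<open>y'\<close>.  A row together with \<open>u\<close> and one of \<open>y\<close>, \<open>y'\<close> is a
  \<open>K\<^sub>q\<close>, and so is a column together with the other one.  Hence the grid edges can be completed to a
  decomposable graph by the star from \<open>y\<close> to \<open>U\<close>, and equally by the star from \<open>y'\<close> to \<open>U\<close>:
  the grid moves a star from \<open>y\<close> to \<open>y'\<close> (\<open>grid_decomposable\<close>, and
  \<open>star_moves_transformer\<close> for many stars at once).

  Star moves carry \<open>L\<close> to a graph that depends only on its number of edges.  Replace each edge
  \<open>x y\<close> of \<open>L\<close> by a petal, a new \<open>K\<^sub>q\<close> without the edge between two of its vertices \<open>s\<close> and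
  \<open>t\<close> (the tips), together with the edges \<open>x s\<close> and \<open>y t\<close>.  This is a single star move,
  after a \<open>K\<^sub>q\<close> on \<open>y\<close> and the petal minus \<open>s\<close> has been added.  Now each vertex of \<open>L\<close> is
  joined to as many tips as its degree, a multiple of \<open>q - 1\<close>, so its edges split into stars with
  \<open>q - 1\<close> leaves, and these are moved to one new vertex, the hub.  What is left are \<open>e(L)\<close>
  petals hanging on a hub (\<open>petal_transformer\<close>).  The graph formed by \<open>k\<close> disjoint copies of
  \<open>K\<^sub>q\<close>, where \<open>e(L)\<close> is \<open>k\<close> times \<open>q choose 2\<close>, reaches the very same petals and hub.
  Gluing both transformations along the petals and adding the \<open>k\<close> cliques gives an absorber: with
  \<open>L\<close> present one uses the decompositions "\<open>L\<close> with the first half" and "petals with the second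
  half" and the \<open>k\<close> cliques, and without \<open>L\<close> one uses "petals with the first half" and "\<open>k\<close>
  cliques with the second half" (\<open>absorber_exists\<close>).

  For the density, the absorber is built up from the roots in four layers: the hub with the \<open>k\<close>
  cliques, the petals, and the two families of grids.  Each vertex has at most three neighbours in
  earlier layers and at most \<open>2 * q - 5\<close> in its own, so it accounts for at most
  \<open>3 + (2 * q - 5) / 2 = q + 1 / 2\<close> edges.  In the grids this is attained.  In a petal or a clique the
  degree within the layer is at most \<open>q - 1\<close>, and \<open>q - 1 \<le> 2 * q - 5\<close> is exactly \<open>q \<ge> 4\<close>.
  That layers of this kind preserve both density conditions is \<open>sparse_attach\<close>.
\<close>

section \<open>Decomposing edge sets into cliques\<close>

definition clique_edges :: "'a set \<Rightarrow> 'a set set" where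
  "clique_edges Q = {{u, v} | u v. u \<in> Q \<and> v \<in> Q \<and> u \<noteq> v}"

text \<open>Only the vertex sets of the cliques are recorded, so that decompositions of edge sets can be
  combined without naming an ambient vertex set.\<close>

definition decomposable :: "nat \<Rightarrow> 'a set set \<Rightarrow> bool" where
  "decomposable q E \<longleftrightarrow> (\<exists>\<Q>. (\<forall>Q\<in>\<Q>. finite Q \<and> card Q = q) \<and>
     disjoint_family_on clique_edges \<Q> \<and> (\<Union>Q\<in>\<Q>. clique_edges Q) = E)"

definition star :: "'a \<Rightarrow> 'a set \<Rightarrow> 'a set set" where
  "star y U = (\<lambda>u. {y, u}) ` U"

lemma star_insert: "star y (insert u U) = insert {y, u} (star y U)"
  by (simp add: star_def)

lemma star_UN: "star y (\<Union>i\<in>I. U i) = (\<Union>i\<in>I. star y (U i))"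
  by (auto simp: star_def)

lemma clique_edges_insert:
  "a \<notin> Q \<Longrightarrow> clique_edges (insert a Q) = star a Q \<union> clique_edges Q"
  by (auto simp: clique_edges_def star_def)

lemma clique_edges_eq: "clique_edges Q = {e. e \<subseteq> Q \<and> card e = 2}"
  by (auto simp: clique_edges_def card_2_iff)

lemma clique_edges_disjoint:
  assumes "A \<inter> B \<subseteq> {c}"
  shows "clique_edges A \<inter> clique_edges B = {}"
proof -
  have False if "e \<in> clique_edges A" "e \<in> clique_edges B" for e
  proof -
    have "e \<subseteq> {c}" "card e = 2" using that assms unfolding clique_edges_eq by auto
    then show False using card_mono[of "{c}" e] by simp
  qed
  then show ?thesis by auto
qed

lemma decomposable_clique: "finite Q \<Longrightarrow> card Q = q \<Longrightarrow> decomposable q (clique_edges Q)"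
  unfolding decomposable_def
  by (rule exI[of _ "{Q}"]) (auto simp: disjoint_family_on_def)

lemma decomposable_UN:
  assumes dec: "\<And>i. i \<in> I \<Longrightarrow> decomposable q (E i)" and disj: "disjoint_family_on E I"
  shows "decomposable q (\<Union>i\<in>I. E i)"
proof -
  obtain \<Q> where \<Q>: "\<And>i. i \<in> I \<Longrightarrow> (\<forall>Q\<in>\<Q> i. finite Q \<and> card Q = q) \<and>
      disjoint_family_on clique_edges (\<Q> i) \<and> (\<Union>Q\<in>\<Q> i. clique_edges Q) = E i"
    using dec unfolding decomposable_def by metis
  have "disjoint_family_on clique_edges (\<Union>i\<in>I. \<Q> i)"
    unfolding disjoint_family_on_def
  proof (intro ballI impI)
    fix Q Q' assume "Q \<in> (\<Union>i\<in>I. \<Q> i)" "Q' \<in> (\<Union>i\<in>I. \<Q> i)" and ne: "Q \<noteq> Q'"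
    then obtain i j where ij: "i \<in> I" "j \<in> I" "Q \<in> \<Q> i" "Q' \<in> \<Q> j" by auto
    then have sub: "clique_edges Q \<subseteq> E i" "clique_edges Q' \<subseteq> E j"
      using \<Q> by blast+
    show "clique_edges Q \<inter> clique_edges Q' = {}"
    proof (cases "i = j")
      case True
      then show ?thesis using \<Q>[of i] ij ne unfolding disjoint_family_on_def by blast
    next
      case False
      then show ?thesis using sub disj ij unfolding disjoint_family_on_def by blast
    qed
  qed
  then show ?thesis
    unfolding decomposable_def using \<Q> by (intro exI[of _ "\<Union>i\<in>I. \<Q> i"]) auto
qed

lemma decomposable_Un:
  assumes "decomposable q E" "decomposable q F" "E \<inter> F = {}"
  shows "decomposable q (E \<union> F)"
proof -
  have "decomposable q (\<Union>b\<in>UNIV. if b then E else F)"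
    by (rule decomposable_UN) (use assms in \<open>auto simp: disjoint_family_on_def split: if_splits\<close>)
  then show ?thesis by (simp add: UNIV_bool Un_commute)
qed

lemma decomposable_cliques:
  assumes "\<And>i. i \<in> I \<Longrightarrow> finite (Q i) \<and> card (Q i) = q"
    and "\<And>i j. i \<in> I \<Longrightarrow> j \<in> I \<Longrightarrow> i \<noteq> j \<Longrightarrow> \<exists>c. Q i \<inter> Q j \<subseteq> {c}"
  shows "decomposable q (\<Union>i\<in>I. clique_edges (Q i))"
proof (rule decomposable_UN)
  show "disjoint_family_on (\<lambda>i. clique_edges (Q i)) I"
    unfolding disjoint_family_on_def using assms(2) clique_edges_disjoint by metis
qed (use assms(1) decomposable_clique in auto)

text \<open>Since \<open>q \<ge> 2\<close>, every vertex of a clique lies on one of its edges, so the vertex sets of the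
  cliques stay inside the graph.\<close>

lemma clique_decomposition_exists:
  assumes dec: "decomposable q (edges G)" and G: "simple_graph G" and q: "q \<ge> 2"
  shows "\<exists>D. clique_decomposition q G D"
proof -
  obtain \<Q> where \<Q>: "\<forall>Q\<in>\<Q>. finite Q \<and> card Q = q" "disjoint_family_on clique_edges \<Q>"
     "(\<Union>Q\<in>\<Q>. clique_edges Q) = edges G"
    using dec unfolding decomposable_def by auto
  define K :: "'a set \<Rightarrow> 'a graph" where "K Q = \<lparr>verts = Q, edges = clique_edges Q\<rparr>" for Q
  have "is_clique_copy q (K Q) \<and> subgraph (K Q) G" if Q: "Q \<in> \<Q>" for Q
  proof -
    have "v \<in> verts G" if "v \<in> Q" for v
    proof -
      have "\<not> Q \<subseteq> {v}"
        using \<Q>(1) Q q by (metis card.empty card.insert card_mono empty_iff finite.emptyI finite_insert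
            le_trans not_numeral_le_zero numeral_le_one_iff One_nat_def semiring_norm(69))
      then obtain w where "w \<in> Q" "w \<noteq> v" by auto
      then have "{v, w} \<in> edges G" using that \<Q>(3) Q unfolding clique_edges_def by blast
      then show ?thesis using G unfolding simple_graph_def by auto
    qed
    moreover have "clique_edges Q \<subseteq> edges G" using \<Q>(3) Q by auto
    moreover have "\<forall>e\<in>clique_edges Q. e \<subseteq> Q \<and> card e = 2" by (simp add: clique_edges_eq)
    moreover have "finite Q" "card Q = q" using \<Q>(1) Q by auto
    ultimately show ?thesis
      unfolding is_clique_copy_def subgraph_def simple_graph_def K_def
      by (simp only: graph.select_convs) (simp add: subset_iff flip: clique_edges_def)
  qed
  moreover have "pairwise (\<lambda>A B. edges A \<inter> edges B = {}) (K ` \<Q>)"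
    using \<Q>(2) unfolding pairwise_def disjoint_family_on_def K_def by auto
  ultimately show ?thesis
    unfolding clique_decomposition_def using \<Q>(3)
    by (intro exI[of _ "K ` \<Q>"]) (auto simp: K_def)
qed

section \<open>Density of graphs built in layers\<close>

text \<open>The edge set \<open>T\<close> joins a new layer \<open>Z\<close> to the old vertices \<open>W\<close>.  The two constants are chosen
  so that a new vertex is charged at most \<open>3 + (2 * q - 5) / 2 = q + 1 / 2\<close> edges, an edge inside the
  layer being shared by its two ends.\<close>

definition attached :: "nat \<Rightarrow> 'a set \<Rightarrow> 'a set \<Rightarrow> 'a set set \<Rightarrow> bool" where
  "attached q W Z T \<longleftrightarrow> finite Z \<and> W \<inter> Z = {} \<and>
     (\<forall>e\<in>T. e \<subseteq> W \<union> Z \<and> card e = 2 \<and> \<not> e \<subseteq> W) \<and>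
     (\<forall>z\<in>Z. card {u\<in>W. {u, z} \<in> T} \<le> 3 \<and> card {u\<in>Z. {u, z} \<in> T} \<le> 2 * q - 5)"

text \<open>Both density conditions for the bound \<open>q + 1 / 2\<close>, with denominators cleared.  The second is
  \<open>(e(H) - 1) / (v(H) - 2) \<le> q + 1 / 2\<close>, required already for \<open>v(H) = 2\<close>: then it says \<open>e(H) \<le> 1\<close>
  and can serve as the start of an induction over layers.\<close>

definition sparse :: "nat \<Rightarrow> 'a set \<Rightarrow> 'a set \<Rightarrow> 'a set set \<Rightarrow> bool" where
  "sparse q R W E \<longleftrightarrow> finite W \<and> (\<forall>e\<in>E. e \<subseteq> W \<and> card e = 2) \<and>
     (\<forall>H\<subseteq>W. 2 * card (E \<inter> Pow H) \<le> (2 * q + 1) * card (H - R) \<and>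
        (card H \<ge> 2 \<longrightarrow> 2 * card (E \<inter> Pow H) + 4 * q \<le> (2 * q + 1) * card H))"

text \<open>Charge each edge between the layer and an old vertex to its new end, and each edge within the layer
  half to either end.\<close>

lemma attached_edge_bound:
  assumes att: "attached q W Z T" and H: "finite H" "H \<subseteq> W \<union> Z"
    and low: "\<And>z. z \<in> Z \<Longrightarrow> card {u\<in>H \<inter> W. {u, z} \<in> T} \<le> d"
  shows "2 * card (T \<inter> Pow H) \<le> (2 * d + (2 * q - 5)) * card (H \<inter> Z)"
proof -
  let ?S = "H \<inter> Z"
  let ?lo = "{e \<in> T \<inter> Pow H. e \<inter> W \<noteq> {}}" and ?eq = "{e \<in> T \<inter> Pow H. e \<subseteq> Z}"
  have finS: "finite ?S" and finT: "finite (T \<inter> Pow H)" using H by auto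
  have lo_sub: "?lo \<subseteq> (\<Union>z\<in>?S. (\<lambda>u. {u, z}) ` {u\<in>H \<inter> W. {u, z} \<in> T})"
  proof
    fix e assume e: "e \<in> ?lo"
    then have "card e = 2" using att unfolding attached_def by auto
    then obtain u v where uv: "e = {u, v}" "u \<noteq> v" by (auto simp: card_2_iff)
    then have "(u \<in> W \<and> v \<in> ?S) \<or> (v \<in> W \<and> u \<in> ?S)"
      using e att H unfolding attached_def by auto
    then obtain w z where "e = {w, z}" "w \<in> W" "z \<in> ?S" using uv(1) by (metis insert_commute)
    then show "e \<in> (\<Union>z\<in>?S. (\<lambda>u. {u, z}) ` {u\<in>H \<inter> W. {u, z} \<in> T})"
      using e by auto
  qed
  have "card ?lo \<le> card (\<Union>z\<in>?S. (\<lambda>u. {u, z}) ` {u\<in>H \<inter> W. {u, z} \<in> T})"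
    by (rule card_mono[OF _ lo_sub]) (use H in auto)
  also have "\<dots> \<le> (\<Sum>z\<in>?S. card ((\<lambda>u. {u, z}) ` {u\<in>H \<inter> W. {u, z} \<in> T}))"
    by (rule card_UN_le[OF finS])
  also have "\<dots> \<le> (\<Sum>z\<in>?S. d)"
    by (rule sum_mono) (use H low in \<open>auto intro!: order_trans[OF card_image_le]\<close>)
  finally have lo: "card ?lo \<le> d * card ?S" by (simp add: mult.commute)
  have "(\<Sum>z\<in>?S. card {e\<in>?eq. z \<in> e}) = (\<Sum>e\<in>?eq. 2)"
  proof (rule sum_multicount_gen)
    show "\<forall>e\<in>?eq. card {z \<in> ?S. z \<in> e} = 2"
    proof
      fix e assume e: "e \<in> ?eq"
      then have "{z \<in> ?S. z \<in> e} = e" by auto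
      then show "card {z \<in> ?S. z \<in> e} = 2" using e att unfolding attached_def by auto
    qed
  qed (auto simp: finS intro: finite_subset[OF _ finT])
  moreover have "(\<Sum>z\<in>?S. card {e\<in>?eq. z \<in> e}) \<le> (\<Sum>z\<in>?S. 2 * q - 5)"
  proof (rule sum_mono)
    fix z assume z: "z \<in> ?S"
    have "{e\<in>?eq. z \<in> e} \<subseteq> (\<lambda>u. {u, z}) ` {u\<in>Z. {u, z} \<in> T}"
    proof
      fix e assume e: "e \<in> {e\<in>?eq. z \<in> e}"
      then have "card e = 2" using att unfolding attached_def by auto
      then obtain u v where uv: "e = {u, v}" "u \<noteq> v" by (auto simp: card_2_iff)
      then obtain w where "e = {w, z}" using e by (metis (no_types, lifting) insert_commute
            insert_iff mem_Collect_eq singletonD)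
      then show "e \<in> (\<lambda>u. {u, z}) ` {u\<in>Z. {u, z} \<in> T}"
        using e by auto
    qed
    then have "card {e\<in>?eq. z \<in> e} \<le> card ((\<lambda>u. {u, z}) ` {u\<in>Z. {u, z} \<in> T})"
      by (rule card_mono[rotated]) (use att in \<open>simp add: attached_def\<close>)
    also have "\<dots> \<le> card {u\<in>Z. {u, z} \<in> T}"
      by (rule card_image_le) (use att in \<open>simp add: attached_def\<close>)
    also have "\<dots> \<le> 2 * q - 5" using att z unfolding attached_def by auto
    finally show "card {e\<in>?eq. z \<in> e} \<le> 2 * q - 5" .
  qed
  ultimately have eq: "2 * card ?eq \<le> (2 * q - 5) * card ?S" by (simp add: mult.commute)
  have "T \<inter> Pow H \<subseteq> ?lo \<union> ?eq" using H by auto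
  then have "card (T \<inter> Pow H) \<le> card (?lo \<union> ?eq)"
    by (rule card_mono[rotated]) (auto intro: finite_subset[OF _ finT])
  also have "\<dots> \<le> card ?lo + card ?eq" by (rule card_Un_le)
  finally show ?thesis using lo eq by (simp add: algebra_simps)
qed

lemma card_edges_le:
  assumes "finite H" "\<forall>e\<in>T. card e = 2"
  shows "2 * card (T \<inter> Pow H) \<le> card H * (card H - 1)"
proof -
  have "card (T \<inter> Pow H) \<le> card {e. e \<subseteq> H \<and> card e = 2}"
    by (rule card_mono) (use assms in auto)
  also have "\<dots> = card H choose 2" by (rule n_subsets) fact
  finally have "2 * card (T \<inter> Pow H) \<le> 2 * (card H choose 2)" by simp
  also have "\<dots> = card H * (card H - 1)" 
    unfolding choose_two by (rule dvd_mult_div_cancel) auto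
  finally show ?thesis .
qed

text \<open>The charge per new vertex gives the first condition, and it also gives the second one whenever
  \<open>H\<close> contains two old vertices.  If \<open>H\<close> contains at most one, then a new vertex has at most one old
  neighbour in \<open>H\<close> and is charged at most \<open>q - 3 / 2\<close>, so \<open>2 * e(H) \<le> (2 * q - 3) * v(H)\<close>, which
  suffices when \<open>v(H) \<ge> 2 * q\<close>.  Smaller \<open>H\<close> satisfy the condition because they have at most
  \<open>v(H) choose 2\<close> edges.\<close>

lemma sparse_attach:
  assumes sp: "sparse q R W E" and att: "attached q W Z T" and R: "R \<subseteq> W" and q: "q \<ge> 4"
  shows "sparse q R (W \<union> Z) (E \<union> T)"
proof -
  have fin: "finite (W \<union> Z)" using sp att unfolding sparse_def attached_def by auto
  have "2 * card ((E \<union> T) \<inter> Pow H) \<le> (2 * q + 1) * card (H - R) \<and>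
      (card H \<ge> 2 \<longrightarrow> 2 * card ((E \<union> T) \<inter> Pow H) + 4 * q \<le> (2 * q + 1) * card H)"
    if H: "H \<subseteq> W \<union> Z" for H
  proof -
    have finH: "finite H" using H fin finite_subset by blast
    have WZ: "W \<inter> Z = {}" using att unfolding attached_def by auto
    have finW: "finite W" using fin by auto
    have split: "card ((E \<union> T) \<inter> Pow H) \<le> card (E \<inter> Pow (H \<inter> W)) + card (T \<inter> Pow H)"
    proof -
      have "(E \<union> T) \<inter> Pow H = (E \<inter> Pow (H \<inter> W)) \<union> (T \<inter> Pow H)"
        using sp unfolding sparse_def by auto
      then show ?thesis using card_Un_le by metis
    qed
    have T: "2 * card (T \<inter> Pow H) \<le> (2 * q + 1) * card (H \<inter> Z)"
    proof -
      have "card {u\<in>H \<inter> W. {u, z} \<in> T} \<le> 3" if "z \<in> Z" for z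
      proof -
        have "card {u\<in>H \<inter> W. {u, z} \<in> T} \<le> card {u\<in>W. {u, z} \<in> T}"
          by (rule card_mono) (use finW in auto)
        then show ?thesis using that att unfolding attached_def by fastforce
      qed
      from attached_edge_bound[OF att finH H this] show ?thesis using q by simp
    qed
    have HW: "H \<inter> W \<subseteq> W" by auto
    have E1: "2 * card (E \<inter> Pow (H \<inter> W)) \<le> (2 * q + 1) * card (H \<inter> W - R)"
      using sp HW unfolding sparse_def by blast
    have c: "card (H - R) = card (H \<inter> W - R) + card (H \<inter> Z)"
    proof -
      have "H - R = (H \<inter> W - R) \<union> (H \<inter> Z)" using H R WZ by auto
      then show ?thesis using card_Un_disjoint[of "H \<inter> W - R" "H \<inter> Z"] finH WZ by auto
    qed
    have c': "card H = card (H \<inter> W) + card (H \<inter> Z)"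
    proof -
      have "H = (H \<inter> W) \<union> (H \<inter> Z)" using H by auto
      then show ?thesis using card_Un_disjoint[of "H \<inter> W" "H \<inter> Z"] finH WZ by auto
    qed
    have one: "2 * card ((E \<union> T) \<inter> Pow H) \<le> (2 * q + 1) * card (H - R)"
      using split T E1 unfolding c by (simp add: algebra_simps)
    have two: "2 * card ((E \<union> T) \<inter> Pow H) + 4 * q \<le> (2 * q + 1) * card H" if h2: "card H \<ge> 2"
    proof (cases "card (H \<inter> W) \<ge> 2")
      case True
      then have "2 * card (E \<inter> Pow (H \<inter> W)) + 4 * q \<le> (2 * q + 1) * card (H \<inter> W)"
        using sp HW unfolding sparse_def by blast
      then show ?thesis using split T unfolding c' by (simp add: algebra_simps)
    next
      case False
      then have le1: "card (H \<inter> W) \<le> 1" by simp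
      have ET: "\<forall>e\<in>E \<union> T. card e = 2" using sp att unfolding sparse_def attached_def by auto
      show ?thesis
      proof (cases "card H \<le> 2 * q")
        case True
        have "2 * card ((E \<union> T) \<inter> Pow H) \<le> card H * (card H - 1)"
          by (rule card_edges_le[OF finH ET])
        moreover have "card H * (card H - 1) + 4 * q \<le> (2 * q + 1) * card H"
        proof -
          \<comment> \<open>the difference of the two sides factorises with roots \<open>2\<close> and \<open>2 * q\<close>\<close>
          have "(int (card H) - 2) * (2 * int q - int (card H)) \<ge> 0" using True h2 by simp
          then have "int (card H) * (int (card H) - 1) + 4 * int q \<le> (2 * int q + 1) * int (card H)"
            by (simp add: algebra_simps)
          moreover have "int (card H - 1) = int (card H) - 1" using h2 by simp
          ultimately have "int (card H * (card H - 1) + 4 * q) \<le> int ((2 * q + 1) * card H)"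
            by (simp only: of_nat_add of_nat_mult of_nat_numeral of_nat_1)
          then show ?thesis by (simp only: of_nat_le_iff)
        qed
        ultimately show ?thesis by linarith
      next
        case False
        have "card {u\<in>H \<inter> W. {u, z} \<in> T} \<le> 1" for z
          by (rule order_trans[OF card_mono le1]) (use finH in auto)
        from attached_edge_bound[OF att finH H this]
        have "2 * card (T \<inter> Pow H) \<le> (2 * 1 + (2 * q - 5)) * card (H \<inter> Z)" .
        moreover have "2 * 1 + (2 * q - 5) = 2 * q - 3" using q by simp
        ultimately have "2 * card (T \<inter> Pow H) \<le> (2 * q - 3) * card (H \<inter> Z)" by (simp only:)
        moreover have "2 * card (E \<inter> Pow (H \<inter> W)) \<le> card (H \<inter> W) * (card (H \<inter> W) - 1)"
          by (rule card_edges_le) (use finH ET in auto)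
        then have "card (E \<inter> Pow (H \<inter> W)) = 0" using le1 by simp
        moreover have "(2 * q - 3) * card (H \<inter> Z) \<le> (2 * q - 3) * card H"
          unfolding c' by simp
        moreover have "(2 * q - 3) * card H + 4 * q \<le> (2 * q + 1) * card H"
        proof -
          have "2 * q + 1 = (2 * q - 3) + 4" using q by simp
          then have "(2 * q + 1) * card H = (2 * q - 3) * card H + 4 * card H"
            by (simp only: add_mult_distrib)
          then show ?thesis using False by simp
        qed
        ultimately show ?thesis using split by linarith
      qed
    qed
    show ?thesis using one two by blast
  qed
  moreover have "\<forall>e\<in>E \<union> T. e \<subseteq> W \<union> Z \<and> card e = 2"
    using sp att unfolding sparse_def attached_def by auto
  ultimately show ?thesis using fin unfolding sparse_def by blast
qed

lemma sparse_rooted_two_density: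
  assumes sp: "sparse q R (verts A) (edges A)" and q: "q \<ge> 4"
  shows "rooted_two_density A R \<le> real q + 1 / 2"
proof -
  have fin: "finite (verts A)" "finite (edges A)"
    using sp unfolding sparse_def by (auto intro: finite_subset[of _ "Pow (verts A)"])
  have finsub: "finite {H. subgraph H A}"
  proof (rule finite_subset)
    show "{H. subgraph H A} \<subseteq> (\<lambda>(V, E). \<lparr>verts = V, edges = E\<rparr>) ` (Pow (verts A) \<times> Pow (edges A))"
    proof
      fix H assume "H \<in> {H. subgraph H A}"
      then have "H = (\<lambda>(V, E). \<lparr>verts = V, edges = E\<rparr>) (verts H, edges H)"
        "(verts H, edges H) \<in> Pow (verts A) \<times> Pow (edges A)" by (auto simp: subgraph_def)
      then show "H \<in> (\<lambda>(V, E). \<lparr>verts = V, edges = E\<rparr>) ` (Pow (verts A) \<times> Pow (edges A))" by blast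
    qed
  qed (use fin in auto)
  have max0: "max0 S \<le> real q + 1 / 2" if "finite S" "\<And>s. s \<in> S \<Longrightarrow> s \<le> real q + 1 / 2" for S
    using that unfolding max0_def by (auto intro!: Max.boundedI)
  have H: "card (edges H) \<le> card (edges A \<inter> Pow (verts H))" "verts H \<subseteq> verts A" "finite (verts H)"
    if "subgraph H A" for H
    using that fin unfolding subgraph_def simple_graph_def by (auto intro!: card_mono)
  have "rooted_density A R \<le> real q + 1 / 2"
    unfolding rooted_density_def
  proof (rule max0)
    fix s assume "s \<in> {real (card (edges H')) / real (card (verts H' - R)) | H'.
             subgraph H' A \<and> verts H' - R \<noteq> {}}"
    then obtain H' where s: "s = real (card (edges H')) / real (card (verts H' - R))"
      and H': "subgraph H' A" "verts H' - R \<noteq> {}" by auto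
    have "2 * card (edges A \<inter> Pow (verts H')) \<le> (2 * q + 1) * card (verts H' - R)"
      using sp H(2)[OF H'(1)] unfolding sparse_def by blast
    then have "2 * card (edges H') \<le> (2 * q + 1) * card (verts H' - R)" using H(1)[OF H'(1)] by linarith
    then have "real (2 * card (edges H')) \<le> real ((2 * q + 1) * card (verts H' - R))"
      by (simp only: of_nat_le_iff)
    moreover have "card (verts H' - R) > 0" using H'(2) H(3)[OF H'(1)] by (simp add: card_gt_0_iff)
    ultimately show "s \<le> real q + 1 / 2" unfolding s by (simp add: divide_simps algebra_simps)
  qed (use finsub in \<open>auto intro!: finite_image_set\<close>)
  moreover have "two_density A \<le> real q + 1 / 2"
    unfolding two_density_def
  proof (rule max0)
    fix s assume "s \<in> {(real (card (edges H')) - 1) / (real (card (verts H')) - 2) | H'.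
             subgraph H' A \<and> card (verts H') \<ge> 3}"
    then obtain H' where s: "s = (real (card (edges H')) - 1) / (real (card (verts H')) - 2)"
      and H': "subgraph H' A" "card (verts H') \<ge> 3" by auto
    have "card (verts H') \<ge> 2" using H'(2) by simp
    then have "2 * card (edges A \<inter> Pow (verts H')) + 4 * q \<le> (2 * q + 1) * card (verts H')"
      using sp H(2)[OF H'(1)] unfolding sparse_def by blast
    then have "2 * card (edges H') + 4 * q \<le> (2 * q + 1) * card (verts H')"
      using H(1)[OF H'(1)] by linarith
    then have "real (2 * card (edges H') + 4 * q) \<le> real ((2 * q + 1) * card (verts H'))"
      by (simp only: of_nat_le_iff)
    moreover have "real (card (verts H')) - 2 > 0" using H'(2) by linarith
    ultimately show "s \<le> real q + 1 / 2" unfolding s by (simp add: divide_simps algebra_simps)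
  qed (use finsub in \<open>auto intro!: finite_image_set\<close>)
  ultimately show ?thesis unfolding rooted_two_density_def by simp
qed

section \<open>Moving stars with grids\<close>

definition grid_verts :: "nat \<Rightarrow> 'a set \<Rightarrow> ('a \<Rightarrow> nat \<Rightarrow> 'a) \<Rightarrow> 'a set" where
  "grid_verts q U z = (\<Union>u\<in>U. z u ` {..<q - 2})"

definition grid_edges :: "nat \<Rightarrow> 'a \<Rightarrow> 'a \<Rightarrow> 'a set \<Rightarrow> ('a \<Rightarrow> nat \<Rightarrow> 'a) \<Rightarrow> 'a set set" where
  "grid_edges q y y' U z =
     (\<Union>u\<in>U. star u (z u ` {..<q - 2}) \<union> clique_edges (z u ` {..<q - 2})) \<union>
     (\<Union>i<q - 2. clique_edges ((\<lambda>u. z u i) ` U)) \<union>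
     star y (grid_verts q U z) \<union> star y' (grid_verts q U z)"

definition grid_fits :: "nat \<Rightarrow> 'a \<Rightarrow> 'a \<Rightarrow> 'a set \<Rightarrow> ('a \<Rightarrow> nat \<Rightarrow> 'a) \<Rightarrow> bool" where
  "grid_fits q y y' U z \<longleftrightarrow> y \<noteq> y' \<and> y \<notin> U \<and> y' \<notin> U \<and> finite U \<and> card U = q - 1 \<and>
     inj_on (\<lambda>(u, i). z u i) (U \<times> {..<q - 2}) \<and>
     grid_verts q U z \<inter> insert y (insert y' U) = {}"

lemma grid_edges_commute: "grid_edges q y y' U z = grid_edges q y' y U z"
  by (simp add: grid_edges_def Un_ac)

lemma grid_fits_commute: "grid_fits q y y' U z \<longleftrightarrow> grid_fits q y' y U z"
  by (auto simp: grid_fits_def)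

text \<open>The cliques are the rows extended by \<open>u\<close> and \<open>y\<close>, with \<open>2 + (q - 2)\<close> vertices, and the
  columns extended by \<open>y'\<close>, with \<open>1 + (q - 1)\<close> vertices.  Two rows share only \<open>y\<close>, two columns only
  \<open>y'\<close>, and a row and a column only their crossing point.  As the grid edges are symmetric in \<open>y\<close>
  and \<open>y'\<close>, the star at \<open>y'\<close> is handled by the same statement.\<close>

lemma grid_decomposable:
  assumes fits: "grid_fits q y y' U z" and q: "q \<ge> 2"
  shows "decomposable q (star y U \<union> grid_edges q y y' U z)"
proof -
  define row where "row u = z u ` {..<q - 2}" for u
  define col where "col i = (\<lambda>u. z u i) ` U" for i
  have ne: "y \<noteq> y'" "y \<notin> U" "y' \<notin> U" and U: "finite U" "card U = q - 1"
    using fits by (auto simp: grid_fits_def)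
  have inj: "z u i = z u' i' \<longleftrightarrow> u = u' \<and> i = i'"
    if "u \<in> U" "u' \<in> U" "i < q - 2" "i' < q - 2" for u u' i i'
  proof -
    have "inj_on (\<lambda>(u, i). z u i) (U \<times> {..<q - 2})" using fits by (auto simp: grid_fits_def)
    from inj_onD[OF this, of "(u, i)" "(u', i')"] that show ?thesis by auto
  qed
  have fresh: "z u i \<noteq> y" "z u i \<noteq> y'" "z u i \<notin> U" if "u \<in> U" "i < q - 2" for u i
    using fits that unfolding grid_fits_def grid_verts_def by blast+
  have row_in: "a \<noteq> y \<and> a \<noteq> y' \<and> a \<notin> U" if "u \<in> U" "a \<in> row u" for a u
    using fresh that by (auto simp: row_def)
  have col_in: "a \<noteq> y \<and> a \<noteq> y' \<and> a \<notin> U" if "i < q - 2" "a \<in> col i" for a i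
    using fresh that by (auto simp: col_def)
  have rows: "decomposable q (\<Union>u\<in>U. clique_edges (insert y (insert u (row u))))"
  proof (rule decomposable_cliques)
    fix u assume u: "u \<in> U"
    have "inj_on (z u) {..<q - 2}" using inj u by (auto simp: inj_on_def)
    then have "card (row u) = q - 2" by (simp add: row_def card_image)
    moreover have "u \<notin> row u" "y \<notin> insert u (row u)" using row_in u ne by auto
    moreover have "finite (row u)" by (simp add: row_def)
    ultimately show "finite (insert y (insert u (row u))) \<and> card (insert y (insert u (row u))) = q"
      using q by auto
  next
    fix u u' assume u: "u \<in> U" "u' \<in> U" "u \<noteq> u'"
    have "row u \<inter> row u' = {}" using inj u by (auto simp: row_def)
    then have "insert y (insert u (row u)) \<inter> insert y (insert u' (row u')) \<subseteq> {y}"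
      using row_in u by auto
    then show "\<exists>c. insert y (insert u (row u)) \<inter> insert y (insert u' (row u')) \<subseteq> {c}" by blast
  qed
  have cols: "decomposable q (\<Union>i<q - 2. clique_edges (insert y' (col i)))"
  proof (rule decomposable_cliques)
    fix i assume i: "i \<in> {..<q - 2}"
    have "inj_on (\<lambda>u. z u i) U" using inj i by (auto simp: inj_on_def)
    then have "card (col i) = q - 1" by (simp add: col_def card_image U)
    moreover have "y' \<notin> col i" using col_in i by auto
    moreover have "finite (col i)" by (simp add: col_def U)
    ultimately show "finite (insert y' (col i)) \<and> card (insert y' (col i)) = q"
      using q by auto
  next
    fix i j assume i: "i \<in> {..<q - 2}" "j \<in> {..<q - 2}" "i \<noteq> j"
    then have "col i \<inter> col j = {}" using inj by (auto simp: col_def)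
    then show "\<exists>c. insert y' (col i) \<inter> insert y' (col j) \<subseteq> {c}" by blast
  qed
  have disj: "(\<Union>u\<in>U. clique_edges (insert y (insert u (row u)))) \<inter>
      (\<Union>i<q - 2. clique_edges (insert y' (col i))) = {}"
  proof -
    have "clique_edges (insert y (insert u (row u))) \<inter> clique_edges (insert y' (col i)) = {}"
      if "u \<in> U" "i < q - 2" for u i
    proof (rule clique_edges_disjoint)
      have "row u \<inter> col i \<subseteq> {z u i}" using inj that by (auto simp: row_def col_def)
      then show "insert y (insert u (row u)) \<inter> insert y' (col i) \<subseteq> {z u i}"
        using row_in[OF that(1)] col_in[OF that(2)] ne that by auto
    qed
    then show ?thesis by blast
  qed
  have clr: "clique_edges (insert y (insert u (row u))) =
      insert {y, u} (star y (row u) \<union> star u (row u) \<union> clique_edges (row u))" if "u \<in> U" for u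
  proof -
    have "y \<notin> insert u (row u)" "u \<notin> row u" using row_in that ne by auto
    then show ?thesis by (simp add: clique_edges_insert star_insert Un_assoc)
  qed
  have clc: "clique_edges (insert y' (col i)) = star y' (col i) \<union> clique_edges (col i)"
    if "i < q - 2" for i
    by (rule clique_edges_insert) (use col_in[OF that] in auto)
  have gv: "grid_verts q U z = (\<Union>u\<in>U. row u)" "grid_verts q U z = (\<Union>i<q-2. col i)"
    by (auto simp: grid_verts_def row_def col_def)
  have sty: "star y (grid_verts q U z) = (\<Union>u\<in>U. star y (row u))" unfolding gv(1) star_UN ..
  have sty': "star y' (grid_verts q U z) = (\<Union>i<q-2. star y' (col i))" unfolding gv(2) star_UN ..
  have "star y U \<union> grid_edges q y y' U z =
      (\<Union>u\<in>U. clique_edges (insert y (insert u (row u)))) \<union>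
      (\<Union>i<q - 2. clique_edges (insert y' (col i)))"
  proof -
    have r: "(\<Union>u\<in>U. clique_edges (insert y (insert u (row u)))) =
       star y U \<union> (\<Union>u\<in>U. star y (row u)) \<union> (\<Union>u\<in>U. star u (row u) \<union> clique_edges (row u))"
      by (simp add: clr star_def) blast
    have c: "(\<Union>i<q - 2. clique_edges (insert y' (col i))) =
       (\<Union>i<q-2. star y' (col i)) \<union> (\<Union>i<q - 2. clique_edges (col i))"
      using clc by auto
    show ?thesis unfolding r c grid_edges_def sty sty' row_def[symmetric] col_def[symmetric]
      by (simp only: Un_ac)
  qed
  then show ?thesis using decomposable_Un[OF rows cols disj] by simp
qed

lemma grid_edges_new:
  assumes fits: "grid_fits q y y' U z" and e: "e \<in> grid_edges q y y' U z"
  shows "e \<subseteq> insert y (insert y' U) \<union> grid_verts q U z" "card e = 2" "e \<inter> grid_verts q U z \<noteq> {}"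
proof -
  have fresh: "g \<noteq> y" "g \<noteq> y'" "g \<notin> U" if "g \<in> grid_verts q U z" for g
    using fits that unfolding grid_fits_def by blast+
  have row: "z u ` {..<q - 2} \<subseteq> grid_verts q U z" if "u \<in> U" for u
    using that by (auto simp: grid_verts_def)
  have col: "(\<lambda>u. z u i) ` U \<subseteq> grid_verts q U z" if "i < q - 2" for i
    using that by (auto simp: grid_verts_def)
  have "\<exists>a g. e = {a, g} \<and> g \<in> grid_verts q U z \<and> a \<noteq> g \<and>
      a \<in> insert y (insert y' U) \<union> grid_verts q U z"
    using e unfolding grid_edges_def
  proof (elim UnE UN_E)
    fix u assume u: "u \<in> U" "e \<in> star u (z u ` {..<q - 2})"
    then obtain g where "e = {u, g}" "g \<in> grid_verts q U z" using row by (auto simp: star_def)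
    then show ?thesis using u fresh by blast
  next
    fix u assume u: "u \<in> U" "e \<in> clique_edges (z u ` {..<q - 2})"
    then obtain a b where "e = {a, b}" "a \<in> z u ` {..<q - 2}" "b \<in> z u ` {..<q - 2}" "a \<noteq> b"
      by (auto simp: clique_edges_def)
    then show ?thesis using row[OF u(1)] by blast
  next
    fix i assume i: "i \<in> {..<q - 2}" "e \<in> clique_edges ((\<lambda>u. z u i) ` U)"
    then obtain a b where "e = {a, b}" "a \<in> (\<lambda>u. z u i) ` U" "b \<in> (\<lambda>u. z u i) ` U" "a \<noteq> b"
      by (auto simp: clique_edges_def)
    then show ?thesis using col i(1) by blast
  next
    assume "e \<in> star y (grid_verts q U z)"
    then obtain g where "e = {y, g}" "g \<in> grid_verts q U z" by (auto simp: star_def)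
    then show ?thesis using fresh by blast
  next
    assume "e \<in> star y' (grid_verts q U z)"
    then obtain g where "e = {y', g}" "g \<in> grid_verts q U z" by (auto simp: star_def)
    then show ?thesis using fresh by blast
  qed
  then show "e \<subseteq> insert y (insert y' U) \<union> grid_verts q U z" "card e = 2" "e \<inter> grid_verts q U z \<noteq> {}"
    by auto
qed

lemma grid_edges_nbrs:
  assumes fits: "grid_fits q y y' U z" and u: "u \<in> U" and i: "i < q - 2"
    and e: "{w, z u i} \<in> grid_edges q y y' U z"
  shows "w \<in> {u, y, y'} \<or> w \<in> z u ` ({..<q - 2} - {i}) \<or> w \<in> (\<lambda>v. z v i) ` (U - {u})"
proof -
  have inj: "z u i = z u' i' \<Longrightarrow> u = u' \<and> i = i'" if "u' \<in> U" "i' < q - 2" for u' i'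
  proof -
    have "inj_on (\<lambda>(u, i). z u i) (U \<times> {..<q - 2})" using fits by (auto simp: grid_fits_def)
    from inj_onD[OF this, of "(u, i)" "(u', i')"] that u i
    show "z u i = z u' i' \<Longrightarrow> u = u' \<and> i = i'" by auto
  qed
  have fresh: "z u i \<noteq> y" "z u i \<noteq> y'" "z u i \<notin> U"
    using fits u i unfolding grid_fits_def grid_verts_def by blast+
  show ?thesis
    using e unfolding grid_edges_def
  proof (elim UnE UN_E)
    fix u' assume u': "u' \<in> U" "{w, z u i} \<in> star u' (z u' ` {..<q - 2})"
    then obtain j where j: "{w, z u i} = {u', z u' j}" "j < q - 2" by (auto simp: star_def)
    then have "z u i = z u' j" "w = u'" using fresh u' by (auto simp: doubleton_eq_iff)
    then show ?thesis using inj[OF u'(1) j(2)] by auto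
  next
    fix u' assume u': "u' \<in> U" "{w, z u i} \<in> clique_edges (z u' ` {..<q - 2})"
    then have "z u i \<in> z u' ` {..<q - 2}" "w \<in> z u' ` {..<q - 2}" "w \<noteq> z u i"
      by (auto simp: clique_edges_eq card_2_iff doubleton_eq_iff)
    moreover from this have "u' = u" using inj u' by auto
    ultimately show ?thesis by auto
  next
    fix i' assume i': "i' \<in> {..<q - 2}" "{w, z u i} \<in> clique_edges ((\<lambda>u. z u i') ` U)"
    then have "z u i \<in> (\<lambda>u. z u i') ` U" "w \<in> (\<lambda>u. z u i') ` U" "w \<noteq> z u i"
      by (auto simp: clique_edges_eq card_2_iff doubleton_eq_iff)
    moreover from this have "i' = i" using inj i' by auto
    ultimately show ?thesis by auto
  next
    assume "{w, z u i} \<in> star y (grid_verts q U z)"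
    then show ?thesis using fresh by (auto simp: star_def doubleton_eq_iff)
  next
    assume "{w, z u i} \<in> star y' (grid_verts q U z)"
    then show ?thesis using fresh by (auto simp: star_def doubleton_eq_iff)
  qed
qed

lemma ex_fresh_inj:
  fixes X :: "'b set"
  assumes "finite X" "finite I" "infinite (UNIV :: 'b set)"
  shows "\<exists>f :: 'a \<Rightarrow> 'b. inj_on f I \<and> f ` I \<inter> X = {}"
proof -
  have "infinite (UNIV - X)" using assms by simp
  then obtain B where B: "finite B" "card B = card I" "B \<subseteq> UNIV - X"
    using infinite_arbitrarily_large by blast
  then obtain f where "bij_betw f I B"
    using finite_same_card_bij[OF assms(2)] by metis
  then show ?thesis using B(3) by (intro exI[of _ f]) (auto simp: bij_betw_def)
qed

text \<open>A triple \<open>(y, y', U)\<close> stands for moving the star from \<open>y\<close> to \<open>U\<close> over to \<open>y'\<close>.\<close>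

definition moves_within :: "nat \<Rightarrow> 'a set \<Rightarrow> ('a \<times> 'a \<times> 'a set) set \<Rightarrow> bool" where
  "moves_within q W M \<longleftrightarrow> (\<forall>(y, y', U)\<in>M. y \<in> W \<and> y' \<in> W \<and> U \<subseteq> W \<and>
     y \<noteq> y' \<and> y \<notin> U \<and> y' \<notin> U \<and> card U = q - 1)"

definition old_star :: "'a \<times> 'a \<times> 'a set \<Rightarrow> 'a set set" where
  "old_star = (\<lambda>(y, y', U). star y U)"

definition new_star :: "'a \<times> 'a \<times> 'a set \<Rightarrow> 'a set set" where
  "new_star = (\<lambda>(y, y', U). star y' U)"

text \<open>A crude count of grid vertices: on \<open>w\<close> vertices there are at most \<open>w * (w * 2 ^ w)\<close> moves, and each
  needs at most \<open>w * q\<close> new vertices.\<close>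

definition move_bound :: "nat \<Rightarrow> nat \<Rightarrow> nat" where
  "move_bound q w = w * (w * 2 ^ w) * (w * q)"

lemma move_bound_mono: "w \<le> w' \<Longrightarrow> move_bound q w \<le> move_bound q w'"
  unfolding move_bound_def by (intro mult_le_mono power_increasing) auto

text \<open>Disjoint grids carry out all moves at once.  No order has to be respected: it suffices that the old
  stars are edge-disjoint and that the new stars are edge-disjoint.  The layer of grids meets the bounds of
  \<open>attached\<close> with equality, since \<open>z u i\<close> has the old neighbours \<open>u\<close>, \<open>y\<close>, \<open>y'\<close>, and
  \<open>q - 3\<close> neighbours in its row and \<open>q - 2\<close> in its column.  The set \<open>X\<close> lists further vertices to be
  avoided.\<close>

lemma star_moves_transformer:
  fixes W X :: "nat set"
  assumes q: "q \<ge> 4" and W: "finite W" "W \<subseteq> X" and X: "finite X"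
    and M: "moves_within q W M"
    and old: "disjoint_family_on old_star M" and new: "disjoint_family_on new_star M"
  obtains Z T where "attached q X Z T"
    "card Z \<le> move_bound q (card W)"
    "decomposable q ((\<Union>m\<in>M. old_star m) \<union> T)" "decomposable q ((\<Union>m\<in>M. new_star m) \<union> T)"
proof -
  have Msub: "M \<subseteq> W \<times> W \<times> Pow W" using M by (auto simp: moves_within_def)
  then have finM: "finite M" using W by (auto intro: finite_subset)
  have cardM: "card M \<le> card W * (card W * 2 ^ card W)"
    using card_mono[OF _ Msub] W by (simp add: card_cartesian_product card_Pow)
  define I where "I = M \<times> W \<times> {..<q}"
  have finI: "finite I" using finM W by (simp add: I_def)
  obtain f :: "(nat \<times> nat \<times> nat set) \<times> nat \<times> nat \<Rightarrow> nat" where f: "inj_on f I" "f ` I \<inter> X = {}"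
    using ex_fresh_inj[OF X finI] by auto
  define G where "G m = grid_verts q (snd (snd m)) (\<lambda>u i. f (m, u, i))" for m
  define E where "E m = grid_edges q (fst m) (fst (snd m)) (snd (snd m)) (\<lambda>u i. f (m, u, i))" for m
  define Z where "Z = (\<Union>m\<in>M. G m)"
  define T where "T = (\<Union>m\<in>M. E m)"
  have Gsub: "G m \<subseteq> f ` ({m} \<times> W \<times> {..<q})" if "m \<in> M" for m
    using that Msub unfolding G_def grid_verts_def by (force simp: image_iff)
  have GI: "G m \<subseteq> f ` I" if "m \<in> M" for m using Gsub[OF that] that by (auto simp: I_def)
  have GX: "G m \<inter> X = {}" if "m \<in> M" for m using GI[OF that] f(2) by auto
  have Gdisj: "G m \<inter> G m' = {}" if "m \<in> M" "m' \<in> M" "m \<noteq> m'" for m m'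
  proof -
    have "f ` ({m} \<times> W \<times> {..<q}) \<inter> f ` ({m'} \<times> W \<times> {..<q}) =
        f ` (({m} \<times> W \<times> {..<q}) \<inter> ({m'} \<times> W \<times> {..<q}))"
      by (rule inj_on_image_Int[OF f(1), symmetric]) (use that in \<open>auto simp: I_def\<close>)
    also have "\<dots> = {}" using that by auto
    finally show ?thesis using Gsub[OF that(1)] Gsub[OF that(2)] by blast
  qed
  have fits: "grid_fits q (fst m) (fst (snd m)) (snd (snd m)) (\<lambda>u i. f (m, u, i))" if m: "m \<in> M" for m
  proof -
    obtain y y' U where myU: "m = (y, y', U)" by (cases m)
    have U: "y \<in> W" "y' \<in> W" "U \<subseteq> W" "y \<noteq> y'" "y \<notin> U" "y' \<notin> U" "card U = q - 1"
      using M m unfolding moves_within_def myU by auto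
    have "inj_on (\<lambda>(u, i). f (m, u, i)) (U \<times> {..<q - 2})"
    proof (rule inj_onI, clarify)
      fix u i u' i' assume *: "u \<in> U" "u' \<in> U" "i < q - 2" "i' < q - 2" "f (m, u, i) = f (m, u', i')"
      then have "(m, u, i) = (m, u', i')"
        using U m by (intro inj_onD[OF f(1)]) (auto simp: I_def)
      then show "u = u' \<and> i = i'" by simp
    qed
    moreover have "grid_verts q U (\<lambda>u i. f (m, u, i)) \<inter> insert y (insert y' U) = {}"
      using GX[OF m] U W unfolding G_def myU by auto
    ultimately show ?thesis using U W unfolding grid_fits_def
      by (auto simp: myU intro: finite_subset)
  qed
  have Wm: "insert (fst m) (insert (fst (snd m)) (snd (snd m))) \<subseteq> W" if "m \<in> M" for m
    using Msub that by (cases m) auto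
  have E: "e \<subseteq> W \<union> G m" "card e = 2" "e \<inter> G m \<noteq> {}" if "m \<in> M" "e \<in> E m" for m e
    using grid_edges_new[OF fits[OF that(1)] that(2)[unfolded E_def]] Wm[OF that(1)]
    unfolding G_def by blast+
  have Edisj: "E m \<inter> E m' = {}" if "m \<in> M" "m' \<in> M" "m \<noteq> m'" for m m'
  proof -
    have False if e: "e \<in> E m" "e \<in> E m'" for e
    proof -
      obtain a where a: "a \<in> e" "a \<in> G m" using E(3)[OF \<open>m \<in> M\<close> e(1)] by auto
      then have "a \<in> W \<union> G m'" using E(1)[OF \<open>m' \<in> M\<close> e(2)] by auto
      then show False using a(2) Gdisj[OF \<open>m \<in> M\<close> \<open>m' \<in> M\<close> \<open>m \<noteq> m'\<close>] GX[OF \<open>m \<in> M\<close>] W(2) by auto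
    qed
    then show ?thesis by auto
  qed
  have ZI: "Z \<subseteq> f ` I" unfolding Z_def by (rule UN_least) (rule GI)
  then have finZ: "finite Z" using finI finite_surj by blast
  have att: "attached q X Z T"
    unfolding attached_def
  proof (intro conjI ballI)
    show "finite Z" by fact
    show "X \<inter> Z = {}" using ZI f(2) by auto
    fix e assume "e \<in> T"
    then obtain m where m: "m \<in> M" "e \<in> E m" unfolding T_def by blast
    show "e \<subseteq> X \<union> Z" using E(1)[OF m] W(2) m(1) unfolding Z_def by blast
    show "card e = 2" using E(2)[OF m] .
    show "\<not> e \<subseteq> X" using E(3)[OF m] GX[OF m(1)] by auto
  next
    fix z assume "z \<in> Z"
    then obtain m where m: "m \<in> M" "z \<in> G m" unfolding Z_def by blast
    obtain y y' U where myU: "m = (y, y', U)" by (cases m)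
    obtain u i where ui: "u \<in> U" "i < q - 2" "z = f (m, u, i)"
      using m(2) by (auto simp: G_def grid_verts_def myU)
    have U: "finite U" "card U = q - 1" using fits[OF m(1)] by (auto simp: grid_fits_def myU)
    have nb: "w \<in> {u, y, y'} \<or> w \<in> (\<lambda>i. f (m, u, i)) ` ({..<q - 2} - {i}) \<or>
        w \<in> (\<lambda>v. f (m, v, i)) ` (U - {u})" if wT: "{w, z} \<in> T" for w
    proof -
      obtain m' where m': "m' \<in> M" "{w, z} \<in> E m'" using wT unfolding T_def by blast
      have "z \<in> W \<union> G m'" using E(1)[OF m'] by auto
      then have "m' = m" using GX[OF m(1)] Gdisj[OF m(1) m'(1)] W m(2) by auto
      then show ?thesis using grid_edges_nbrs[OF fits[OF m(1)], of u i w] m'(2) ui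
        unfolding E_def myU by simp
    qed
    have rG: "(\<lambda>i. f (m, u, i)) ` ({..<q - 2} - {i}) \<subseteq> G m" "(\<lambda>v. f (m, v, i)) ` (U - {u}) \<subseteq> G m"
      using ui by (auto simp: G_def grid_verts_def myU)
    have "{w\<in>X. {w, z} \<in> T} \<subseteq> {u, y, y'}" using nb rG GX[OF m(1)] by blast
    then have "card {w\<in>X. {w, z} \<in> T} \<le> card {u, y, y'}" by (rule card_mono[rotated]) simp
    also have "\<dots> \<le> 3" by (simp add: card_insert_if)
    finally show "card {w\<in>X. {w, z} \<in> T} \<le> 3" .
    have "u \<in> W" "y \<in> W" "y' \<in> W" using Wm[OF m(1)] ui(1) by (auto simp: myU)
    then have "{w\<in>Z. {w, z} \<in> T} \<subseteq>
        (\<lambda>i. f (m, u, i)) ` ({..<q - 2} - {i}) \<union> (\<lambda>v. f (m, v, i)) ` (U - {u})"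
      using nb W(2) ZI f(2) by blast
    then have "card {w\<in>Z. {w, z} \<in> T} \<le>
        card ((\<lambda>i. f (m, u, i)) ` ({..<q - 2} - {i}) \<union> (\<lambda>v. f (m, v, i)) ` (U - {u}))"
      by (rule card_mono[rotated]) (use U in auto)
    also have "\<dots> \<le> card ((\<lambda>i. f (m, u, i)) ` ({..<q - 2} - {i})) + card ((\<lambda>v. f (m, v, i)) ` (U - {u}))"
      by (rule card_Un_le)
    also have "\<dots> \<le> card ({..<q - 2} - {i}) + card (U - {u})"
      by (intro add_mono card_image_le) (use U in auto)
    also have "\<dots> = 2 * q - 5" using ui U q by simp
    finally show "card {w\<in>Z. {w, z} \<in> T} \<le> 2 * q - 5" .
  qed
  have cardZ: "card Z \<le> move_bound q (card W)"
  proof -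
    have "card Z \<le> card (f ` I)" by (rule card_mono[OF _ ZI]) (use finI in auto)
    also have "\<dots> \<le> card I" by (rule card_image_le) fact
    also have "\<dots> = card M * (card W * q)" by (simp add: I_def card_cartesian_product)
    also have "\<dots> \<le> (card W * (card W * 2 ^ card W)) * (card W * q)"
      by (rule mult_right_mono) (use cardM in auto)
    finally show ?thesis by (simp only: move_bound_def)
  qed
  have key: "decomposable q ((\<Union>m\<in>M. S m) \<union> T)"
    if S: "disjoint_family_on S M" and SW: "\<And>m e. m \<in> M \<Longrightarrow> e \<in> S m \<Longrightarrow> e \<subseteq> W"
      and dec: "\<And>m. m \<in> M \<Longrightarrow> decomposable q (S m \<union> E m)" for S
  proof -
    have SE: "S m \<inter> E m' = {}" if "m \<in> M" "m' \<in> M" for m m'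
      using SW[OF that(1)] E(3)[OF that(2)] GX[OF that(2)] W by blast
    have "disjoint_family_on (\<lambda>m. S m \<union> E m) M"
      unfolding disjoint_family_on_def
    proof (intro ballI impI)
      fix m m' assume m: "m \<in> M" "m' \<in> M" "m \<noteq> m'"
      have "S m \<inter> S m' = {}" using S m by (auto simp: disjoint_family_on_def)
      then show "(S m \<union> E m) \<inter> (S m' \<union> E m') = {}"
        using SE[OF m(1,2)] SE[OF m(2,1)] Edisj[OF m] by blast
    qed
    then have "decomposable q (\<Union>m\<in>M. S m \<union> E m)" using dec by (rule decomposable_UN[rotated])
    moreover have "(\<Union>m\<in>M. S m \<union> E m) = (\<Union>m\<in>M. S m) \<union> T" by (auto simp: T_def)
    ultimately show ?thesis by simp
  qed
  have old_dec: "decomposable q ((\<Union>m\<in>M. old_star m) \<union> T)"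
  proof (rule key[OF old])
    fix m assume m: "m \<in> M"
    show "e \<subseteq> W" if "e \<in> old_star m" for e
      using that Wm[OF m] by (cases m) (auto simp: old_star_def star_def)
    show "decomposable q (old_star m \<union> E m)"
      using grid_decomposable[OF fits[OF m]] q by (cases m) (auto simp: old_star_def E_def)
  qed
  have new_dec: "decomposable q ((\<Union>m\<in>M. new_star m) \<union> T)"
  proof (rule key[OF new])
    fix m assume m: "m \<in> M"
    show "e \<subseteq> W" if "e \<in> new_star m" for e
      using that Wm[OF m] by (cases m) (auto simp: new_star_def star_def)
    show "decomposable q (new_star m \<union> E m)"
      using grid_decomposable[OF iffD1[OF grid_fits_commute fits[OF m]]] q
      by (cases m) (auto simp: new_star_def E_def grid_edges_commute)
  qed
  show ?thesis by (rule that[OF att cardZ old_dec new_dec])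
qed

section \<open>Turning edges into petals on a hub\<close>

lemma equal_partition:
  assumes "finite A" "m > 0" "m dvd card A"
  shows "\<exists>P. \<Union>P = A \<and> (\<forall>U\<in>P. card U = m) \<and> (\<forall>U\<in>P. \<forall>U'\<in>P. U \<noteq> U' \<longrightarrow> U \<inter> U' = {})"
  using assms
proof (induction "card A" arbitrary: A rule: less_induct)
  case less
  show ?case
  proof (cases "A = {}")
    case True
    then show ?thesis by (intro exI[of _ "{}"]) auto
  next
    case False
    then have "m \<le> card A" using less.prems by (simp add: card_gt_0_iff dvd_imp_le)
    then obtain U where U: "U \<subseteq> A" "card U = m" "finite U"
      by (rule obtain_subset_with_card_n)
    have c: "card (A - U) = card A - m" using U by (simp add: card_Diff_subset)
    have "card (A - U) < card A" using c less.prems \<open>m \<le> card A\<close> by linarith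
    moreover have "m dvd card (A - U)" using c less.prems(3) \<open>m \<le> card A\<close> by simp
    ultimately obtain P where P: "\<Union>P = A - U" "\<forall>U\<in>P. card U = m"
        "\<forall>U\<in>P. \<forall>U'\<in>P. U \<noteq> U' \<longrightarrow> U \<inter> U' = {}"
      using less.hyps[of "A - U"] less.prems by auto
    have "V \<inter> U = {}" if "V \<in> P" for V using P(1) that by blast
    then show ?thesis
      using P U by (intro exI[of _ "insert U P"]) (auto simp: Int_commute)
  qed
qed

text \<open>Petal \<open>i\<close> has the tips \<open>s i\<close> and \<open>t i\<close> and the body \<open>B i\<close>.\<close>

definition petal_verts :: "(nat \<Rightarrow> 'a) \<Rightarrow> (nat \<Rightarrow> 'a) \<Rightarrow> (nat \<Rightarrow> 'a set) \<Rightarrow> nat \<Rightarrow> 'a set" where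
  "petal_verts s t B i = insert (s i) (insert (t i) (B i))"

definition petals :: "nat \<Rightarrow> nat \<Rightarrow> (nat \<Rightarrow> 'a) \<Rightarrow> (nat \<Rightarrow> 'a) \<Rightarrow> (nat \<Rightarrow> 'a set) \<Rightarrow> bool" where
  "petals q n s t B \<longleftrightarrow>
     (\<forall>i<n. s i \<noteq> t i \<and> s i \<notin> B i \<and> t i \<notin> B i \<and> finite (B i) \<and> card (B i) = q - 2) \<and>
     disjoint_family_on (petal_verts s t B) {..<n}"

text \<open>A clique on each petal with the edge between its tips rerouted through the hub \<open>h\<close>.\<close>

definition petal_edges :: "nat \<Rightarrow> 'a \<Rightarrow> (nat \<Rightarrow> 'a) \<Rightarrow> (nat \<Rightarrow> 'a) \<Rightarrow> (nat \<Rightarrow> 'a set) \<Rightarrow> 'a set set" where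
  "petal_edges n h s t B = (\<Union>i<n. {{h, s i}, {h, t i}} \<union> star (s i) (B i) \<union>
     clique_edges (insert (t i) (B i)))"

text \<open>The edges between a graph with edges \<open>x i y i\<close> and its petals that occur on the way.  Besides
  \<open>x i s i\<close> and \<open>y i t i\<close> these are the edges from \<open>y i\<close> to the body, which come from the clique
  added at \<open>y i\<close>.  Each petal vertex is on exactly one of them.\<close>

definition link_edges :: "nat \<Rightarrow> (nat \<Rightarrow> 'a) \<Rightarrow> (nat \<Rightarrow> 'a) \<Rightarrow> (nat \<Rightarrow> 'a) \<Rightarrow> (nat \<Rightarrow> 'a) \<Rightarrow> (nat \<Rightarrow> 'a set) \<Rightarrow> 'a set set" where
  "link_edges n x y s t B = (\<Union>i<n. insert {x i, s i} (star (y i) (insert (t i) (B i))))"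

lemma disjoint_family_on_UnI:
  assumes "disjoint_family_on S A" "disjoint_family_on S B"
    and "\<And>a b. a \<in> A \<Longrightarrow> b \<in> B \<Longrightarrow> S a \<inter> S b = {}"
  shows "disjoint_family_on S (A \<union> B)"
  using assms unfolding disjoint_family_on_def by blast

text \<open>There are two kinds of moves.  For each edge, the star from \<open>y i\<close> to \<open>x i\<close> and the body goes
  to \<open>s i\<close>; for each vertex \<open>v\<close>, a partition of the tips linked to \<open>v\<close> into sets of size
  \<open>q - 1\<close> gives stars that go to the hub.  The old stars are exactly the given graph and the links.  The new
  stars, together with the cliques on \<open>y i\<close>, \<open>t i\<close> and the body, are exactly the petals and the
  links.  The edges from \<open>y i\<close> to the body occur in the old stars and again in these cliques, and so
  belong to both decompositions.\<close>

lemma petal_transformer: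
  fixes V X P :: "nat set" and x y s t :: "nat \<Rightarrow> nat" and B :: "nat \<Rightarrow> nat set"
  assumes P_def: "P = (\<Union>i<n. petal_verts s t B i)" and q: "q \<ge> 4" and V: "finite V" and pet: "petals q n s t B"
    and xy: "\<And>i. i < n \<Longrightarrow> x i \<in> V \<and> y i \<in> V \<and> x i \<noteq> y i"
    and inj: "inj_on (\<lambda>i. {x i, y i}) {..<n}"
    and deg: "\<And>v. v \<in> V \<Longrightarrow> (q - 1) dvd card {i. i < n \<and> x i = v} + card {i. i < n \<and> y i = v}"
    and h: "h \<notin> V" and P: "P \<inter> insert h V = {}"
    and X: "finite X" "insert h V \<union> P \<subseteq> X"
  obtains Z T where "attached q X Z T"
    "card Z \<le> move_bound q (card (insert h V \<union> P))"
    "decomposable q ((\<lambda>i. {x i, y i}) ` {..<n} \<union> link_edges n x y s t B \<union> T)"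
    "decomposable q (petal_edges n h s t B \<union> link_edges n x y s t B \<union> T)"
proof -
  define W where "W = insert h V \<union> P"
  have pi: "s i \<noteq> t i" "s i \<notin> B i" "t i \<notin> B i" "finite (B i)" "card (B i) = q - 2" if "i < n" for i
    using pet that by (auto simp: petals_def)
  have pP: "s i \<in> P" "t i \<in> P" "B i \<subseteq> P" if "i < n" for i
    using that by (auto simp: P_def petal_verts_def)
  have pV: "s i \<notin> V" "t i \<notin> V" "s i \<noteq> h" "t i \<noteq> h" "B i \<inter> V = {}" "h \<notin> B i" if "i < n" for i
    using pP[OF that] P by auto
  have same: "i = j" if "a \<in> petal_verts s t B i" "a \<in> petal_verts s t B j" "i < n" "j < n" for a i j
    using pet that unfolding petals_def disjoint_family_on_def by blast
  have ss: "s i = s j \<longleftrightarrow> i = j" "t i = t j \<longleftrightarrow> i = j" "s i \<noteq> t j" "s i \<notin> B j" "t i \<notin> B j"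
    if "i < n" "j < n" for i j
    using same[OF _ _ that, of "s i"] same[OF _ _ that, of "t i"] pi[OF that(1)]
    by (auto simp: petal_verts_def)
  have BB: "B i \<inter> B j = {}" if "i < n" "j < n" "i \<noteq> j" for i j
    using same[OF _ _ that(1,2)] that(3) by (auto simp: petal_verts_def)
  define ends where "ends v = s ` {i. i < n \<and> x i = v} \<union> t ` {i. i < n \<and> y i = v}" for v
  have "\<exists>G. \<Union>G = ends v \<and> (\<forall>U\<in>G. card U = q - 1) \<and> (\<forall>U\<in>G. \<forall>U'\<in>G. U \<noteq> U' \<longrightarrow> U \<inter> U' = {})"
    if "v \<in> V" for v
  proof (rule equal_partition)
    have "card (ends v) = card (s ` {i. i < n \<and> x i = v}) + card (t ` {i. i < n \<and> y i = v})"
      unfolding ends_def by (rule card_Un_disjoint) (use ss in auto)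
    also have "card (s ` {i. i < n \<and> x i = v}) = card {i. i < n \<and> x i = v}"
      by (rule card_image) (use ss in \<open>auto simp: inj_on_def\<close>)
    also have "card (t ` {i. i < n \<and> y i = v}) = card {i. i < n \<and> y i = v}"
      by (rule card_image) (use ss in \<open>auto simp: inj_on_def\<close>)
    finally show "(q - 1) dvd card (ends v)" using deg[OF that] by simp
  qed (use q in \<open>auto simp: ends_def\<close>)
  then obtain G where G: "\<And>v. v \<in> V \<Longrightarrow> \<Union>(G v) = ends v"
      "\<And>v U. v \<in> V \<Longrightarrow> U \<in> G v \<Longrightarrow> card U = q - 1"
      "\<And>v U U'. v \<in> V \<Longrightarrow> U \<in> G v \<Longrightarrow> U' \<in> G v \<Longrightarrow> U \<noteq> U' \<Longrightarrow> U \<inter> U' = {}"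
    by metis
  have GE: "U \<subseteq> ends v" if "v \<in> V" "U \<in> G v" for v U using G(1) that by blast
  have endsP: "ends v \<subseteq> P" for v using pP by (auto simp: ends_def)
  have ends_disj: "v = v'" if "a \<in> ends v" "a \<in> ends v'" for a v v'
    using that ss ss(3)[symmetric] by (auto simp: ends_def)
  have endsB: "ends v \<inter> B i = {}" if "i < n" for v i using that ss by (auto simp: ends_def)
  \<comment> \<open>moves of the first kind replace edges by petals, those of the second kind go to the hub\<close>
  define M1 where "M1 = (\<lambda>i. (y i, s i, insert (x i) (B i))) ` {..<n}"
  define M2 where "M2 = {(v, h, U) | v U. v \<in> V \<and> U \<in> G v}"
  have mw: "moves_within q W (M1 \<union> M2)"
  proof -
    have "y i \<in> W \<and> s i \<in> W \<and> insert (x i) (B i) \<subseteq> W \<and> y i \<noteq> s i \<and> y i \<notin> insert (x i) (B i) \<and>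
        s i \<notin> insert (x i) (B i) \<and> card (insert (x i) (B i)) = q - 1" if i: "i < n" for i
    proof -
      have xB: "x i \<notin> B i" "y i \<notin> B i" using xy[OF i] pV(5)[OF i] by auto
      have "card (insert (x i) (B i)) = q - 1" using xB pi[OF i] q by simp
      then show ?thesis using xB xy[OF i] pV[OF i] pP[OF i] pi[OF i] by (auto simp: W_def)
    qed
    moreover have "v \<in> W \<and> h \<in> W \<and> U \<subseteq> W \<and> v \<noteq> h \<and> v \<notin> U \<and> h \<notin> U \<and> card U = q - 1"
      if "v \<in> V" "U \<in> G v" for v U
      using that G(2) GE[OF that] endsP[of v] P h by (auto simp: W_def)
    ultimately show ?thesis unfolding moves_within_def M1_def M2_def
      by (intro ballI; elim UnE imageE CollectE exE conjE; hypsubst; simp)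
  qed
  have old: "disjoint_family_on old_star (M1 \<union> M2)"
  proof (rule disjoint_family_on_UnI)
    have "star (y i) (insert (x i) (B i)) \<inter> star (y j) (insert (x j) (B j)) = {}"
      if ij: "i < n" "j < n" "i \<noteq> j" for i j
    proof -
      have "{x i, y i} \<noteq> {x j, y j}" using inj ij unfolding inj_on_def by blast
      then show ?thesis using BB[OF ij] pV(5)[OF ij(1)] pV(5)[OF ij(2)] xy[OF ij(1)] xy[OF ij(2)]
        by (auto simp: star_def doubleton_eq_iff)
    qed
    then show "disjoint_family_on old_star M1"
      unfolding disjoint_family_on_def M1_def old_star_def by fastforce
    have "star v U \<inter> star v' U' = {}"
      if "v \<in> V" "U \<in> G v" "v' \<in> V" "U' \<in> G v'" "(v, U) \<noteq> (v', U')" for v U v' U'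
    proof -
      have UP: "U \<subseteq> P" "U' \<subseteq> P" using that GE endsP by blast+
      have "a \<notin> U'" if "a \<in> U" "v = v'" for a
        using G(3)[of v U U'] that \<open>v \<in> V\<close> \<open>U \<in> G v\<close> \<open>U' \<in> G v'\<close> \<open>(v, U) \<noteq> (v', U')\<close> by auto
      moreover have "v \<notin> U'" "v' \<notin> U" using UP that(1,3) P by auto
      ultimately show ?thesis by (auto simp: star_def doubleton_eq_iff)
    qed
    then show "disjoint_family_on old_star M2"
      unfolding disjoint_family_on_def M2_def old_star_def by fastforce
    have "star (y i) (insert (x i) (B i)) \<inter> star v U = {}"
      if i: "i < n" and v: "v \<in> V" "U \<in> G v" for i v U
    proof -
      have "U \<inter> V = {}" "U \<inter> B i = {}" using GE[OF v] endsP[of v] endsB[OF i, of v] P by blast+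
      moreover have "y i \<notin> U" "v \<notin> B i" "x i \<notin> U"
        using calculation xy[OF i] v pV(5)[OF i] by auto
      ultimately show ?thesis by (auto simp: star_def doubleton_eq_iff)
    qed
    then show "old_star a \<inter> old_star b = {}" if "a \<in> M1" "b \<in> M2" for a b
      using that unfolding M1_def M2_def old_star_def by auto
  qed
  have new: "disjoint_family_on new_star (M1 \<union> M2)"
  proof (rule disjoint_family_on_UnI)
    have "star (s i) (insert (x i) (B i)) \<inter> star (s j) (insert (x j) (B j)) = {}"
      if ij: "i < n" "j < n" "i \<noteq> j" for i j
      using BB[OF ij] pV[OF ij(1)] pV[OF ij(2)] xy[OF ij(1)] xy[OF ij(2)] ss[OF ij(1,2)]
        ss[OF ij(2,1)] ij(3) by (auto simp: star_def doubleton_eq_iff)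
    then show "disjoint_family_on new_star M1"
      unfolding disjoint_family_on_def M1_def new_star_def by fastforce
    have "star h U \<inter> star h U' = {}"
      if "v \<in> V" "U \<in> G v" "v' \<in> V" "U' \<in> G v'" "(v, U) \<noteq> (v', U')" for v U v' U'
    proof -
      have "U \<inter> U' = {}"
      proof (cases "v = v'")
        case True
        then show ?thesis using G(3)[of v U U'] that by auto
      next
        case False
        then show ?thesis using GE[OF that(1,2)] GE[OF that(3,4)] ends_disj by blast
      qed
      then show ?thesis by (auto simp: star_def doubleton_eq_iff)
    qed
    then show "disjoint_family_on new_star M2"
      unfolding disjoint_family_on_def M2_def new_star_def by fastforce
    have "star (s i) (insert (x i) (B i)) \<inter> star h U = {}"
      if i: "i < n" and v: "v \<in> V" "U \<in> G v" for i v U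
      using xy[OF i] h pV[OF i] by (auto simp: star_def doubleton_eq_iff)
    then show "new_star a \<inter> new_star b = {}" if "a \<in> M1" "b \<in> M2" for a b
      using that unfolding M1_def M2_def new_star_def by auto
  qed
  have finW: "finite W" unfolding W_def by (rule finite_subset[OF X(2,1)])
  obtain Z T where ZT: "attached q X Z T"
    "card Z \<le> move_bound q (card W)"
    "decomposable q ((\<Union>m\<in>M1 \<union> M2. old_star m) \<union> T)"
    "decomposable q ((\<Union>m\<in>M1 \<union> M2. new_star m) \<union> T)"
    by (rule star_moves_transformer[OF q finW _ X(1) mw old new]) (use X(2) in \<open>auto simp: W_def\<close>)
  have m2: "(\<Union>m\<in>M2. old_star m) = (\<Union>v\<in>V. star v (ends v))"
     "(\<Union>m\<in>M2. new_star m) = (\<Union>v\<in>V. star h (ends v))"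
  proof -
    have "(\<Union>m\<in>M2. old_star m) = (\<Union>v\<in>V. \<Union>U\<in>G v. star v U)"
      "(\<Union>m\<in>M2. new_star m) = (\<Union>v\<in>V. \<Union>U\<in>G v. star h U)"
      by (auto simp: M2_def old_star_def new_star_def)
    moreover have "(\<Union>U\<in>G v. star a U) = star a (ends v)" if "v \<in> V" for v a
      using G(1)[OF that] star_UN[of a id "G v"] by simp
    ultimately show "(\<Union>m\<in>M2. old_star m) = (\<Union>v\<in>V. star v (ends v))"
     "(\<Union>m\<in>M2. new_star m) = (\<Union>v\<in>V. star h (ends v))" by auto
  qed
  have e_old: "(\<Union>v\<in>V. star v (ends v)) = (\<Union>i<n. {{x i, s i}, {y i, t i}})"
    using xy unfolding star_def ends_def by blast
  have e_new: "(\<Union>v\<in>V. star h (ends v)) = (\<Union>i<n. {{h, s i}, {h, t i}})"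
    using xy unfolding star_def ends_def by blast
  have o: "(\<lambda>i. {x i, y i}) ` {..<n} \<union> link_edges n x y s t B = (\<Union>m\<in>M1 \<union> M2. old_star m)"
    unfolding UN_Un m2 e_old unfolding link_edges_def M1_def old_star_def
    by (auto simp: star_insert insert_commute)
  \<comment> \<open>the cliques that are added before the moves\<close>
  define K where "K = (\<Union>i<n. clique_edges (insert (y i) (insert (t i) (B i))))"
  have Ksub: "e \<inter> s ` {..<n} = {} \<and> h \<notin> e \<and> e \<subseteq> W" if eK: "e \<in> K" for e
  proof -
    obtain i where i: "i < n" "e \<subseteq> insert (y i) (insert (t i) (B i))"
      using eK by (auto simp: K_def clique_edges_eq)
    have "s j \<noteq> y i \<and> s j \<noteq> t i \<and> s j \<notin> B i" if "j < n" for j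
      using ss[OF that i(1)] xy[OF i(1)] pV[OF that] by auto
    then show ?thesis using i pV[OF i(1)] pP[OF i(1)] xy[OF i(1)] h by (auto simp: W_def)
  qed
  have Kdec: "decomposable q K"
    unfolding K_def
  proof (rule decomposable_cliques)
    fix i assume "i \<in> {..<n}"
    then have i: "i < n" by simp
    have "y i \<notin> insert (t i) (B i)" using xy[OF i] pV[OF i] by auto
    then show "finite (insert (y i) (insert (t i) (B i))) \<and> card (insert (y i) (insert (t i) (B i))) = q"
      using pi[OF i] q by auto
  next
    fix i j assume "i \<in> {..<n}" "j \<in> {..<n}" and ne: "i \<noteq> j"
    then have ij: "i < n" "j < n" by auto
    have "insert (y i) (insert (t i) (B i)) \<inter> insert (y j) (insert (t j) (B j)) \<subseteq> {y i}"
      using BB[OF ij ne] ss[OF ij] ss[OF ij(2,1)] pV[OF ij(1)] pV[OF ij(2)] xy[OF ij(1)] xy[OF ij(2)] ne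
      by auto
    then show "\<exists>c. insert (y i) (insert (t i) (B i)) \<inter> insert (y j) (insert (t j) (B j)) \<subseteq> {c}" by blast
  qed
  have Kdisj: "((\<Union>m\<in>M1 \<union> M2. new_star m) \<union> T) \<inter> K = {}"
  proof -
    have "e \<notin> K" if "e \<in> new_star m" "m \<in> M1 \<union> M2" for e m
    proof -
      have "e \<inter> s ` {..<n} \<noteq> {} \<or> h \<in> e" using that
        by (auto simp: M1_def M2_def new_star_def star_def)
      then show ?thesis using Ksub by blast
    qed
    moreover have "e \<notin> K" if eT: "e \<in> T" for e
    proof -
      have "\<not> e \<subseteq> X" using ZT(1) eT unfolding attached_def by auto
      then show ?thesis using Ksub[of e] X(2) unfolding W_def by blast
    qed
    ultimately show ?thesis by blast
  qed
  have n: "petal_edges n h s t B \<union> link_edges n x y s t B = (\<Union>m\<in>M1 \<union> M2. new_star m) \<union> K"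
  proof -
    have "clique_edges (insert (y i) (insert (t i) (B i))) =
        star (y i) (insert (t i) (B i)) \<union> clique_edges (insert (t i) (B i))" if "i < n" for i
      by (rule clique_edges_insert) (use xy[OF that] pV[OF that] in auto)
    then have K: "K = (\<Union>i<n. star (y i) (insert (t i) (B i)) \<union> clique_edges (insert (t i) (B i)))"
      by (simp add: K_def)
    have M1: "(\<Union>m\<in>M1. new_star m) = (\<Union>i<n. insert {x i, s i} (star (s i) (B i)))"
      by (auto simp: M1_def new_star_def star_insert insert_commute)
    show ?thesis
      unfolding UN_Un m2 e_new K M1 unfolding petal_edges_def link_edges_def by blast
  qed
  show ?thesis
  proof (rule that[OF ZT(1)])
    show "card Z \<le> move_bound q (card (insert h V \<union> P))"
      using ZT(2) by (simp only: W_def)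
    show "decomposable q ((\<lambda>i. {x i, y i}) ` {..<n} \<union> link_edges n x y s t B \<union> T)"
      using ZT(3) o by simp
    have "petal_edges n h s t B \<union> link_edges n x y s t B \<union> T =
        ((\<Union>m\<in>M1 \<union> M2. new_star m) \<union> T) \<union> K" unfolding n by blast
    then show "decomposable q (petal_edges n h s t B \<union> link_edges n x y s t B \<union> T)"
      using decomposable_Un[OF ZT(4) Kdec Kdisj] by simp
  qed
qed

section \<open>The common skeleton\<close>

lemma enumerate_edges:
  assumes "finite E" "\<And>e. e \<in> E \<Longrightarrow> card e = 2"
  obtains x y where "inj_on (\<lambda>i. {x i, y i}) {..<card E}" "(\<lambda>i. {x i, y i}) ` {..<card E} = E"
    "\<And>i. i < card E \<Longrightarrow> x i \<noteq> y i"
proof -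
  obtain e where e: "bij_betw e {..<card E} E"
    using ex_bij_betw_nat_finite[OF assms(1)] by (auto simp: atLeast0LessThan)
  have "\<exists>a b. e i = {a, b} \<and> a \<noteq> b" if "i < card E" for i
    using assms(2)[of "e i"] e that by (auto simp: bij_betw_def card_2_iff)
  then obtain x y where xy: "\<And>i. i < card E \<Longrightarrow> e i = {x i, y i} \<and> x i \<noteq> y i" by metis
  have "inj_on (\<lambda>i. {x i, y i}) {..<card E} \<longleftrightarrow> inj_on e {..<card E}"
    by (rule inj_on_cong) (use xy in auto)
  moreover have "(\<lambda>i. {x i, y i}) ` {..<card E} = e ` {..<card E}"
    by (rule image_cong) (use xy in auto)
  ultimately show ?thesis using e xy that[of x y] by (auto simp: bij_betw_def)
qed

lemma degree_enumerated:
  fixes n :: nat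
  assumes inj: "inj_on (\<lambda>i. {x i, y i}) {..<n}" and ne: "\<And>i. i < n \<Longrightarrow> x i \<noteq> y i"
  shows "card {e \<in> (\<lambda>i. {x i, y i}) ` {..<n}. v \<in> e} =
    card {i. i < n \<and> x i = v} + card {i. i < n \<and> y i = v}"
proof -
  have "{e \<in> (\<lambda>i. {x i, y i}) ` {..<n}. v \<in> e} = (\<lambda>i. {x i, y i}) ` {i. i < n \<and> (x i = v \<or> y i = v)}"
    by auto
  then have "card {e \<in> (\<lambda>i. {x i, y i}) ` {..<n}. v \<in> e} = card {i. i < n \<and> (x i = v \<or> y i = v)}"
    using card_image[OF inj_on_subset[OF inj, of "{i. i < n \<and> (x i = v \<or> y i = v)}"]] by auto
  also have "{i. i < n \<and> (x i = v \<or> y i = v)} = {i. i < n \<and> x i = v} \<union> {i. i < n \<and> y i = v}"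
    by auto
  also have "card \<dots> = card {i. i < n \<and> x i = v} + card {i. i < n \<and> y i = v}"
    by (rule card_Un_disjoint) (use ne ne[symmetric] in auto)
  finally show ?thesis .
qed

lemma clique_nbrs: "{u, v} \<in> clique_edges Q \<Longrightarrow> u \<in> Q - {v} \<and> v \<in> Q"
  by (auto simp: clique_edges_def doubleton_eq_iff)

lemma disjoint_cliques:
  assumes Qall: "\<forall>c<k. finite (Q c) \<and> card (Q c) = q" and disj: "disjoint_family_on Q {..<k}"
    and q: "q > 0"
  defines "E \<equiv> (\<Union>c<k. clique_edges (Q c))"
  shows "card E = k * (q choose 2)" "decomposable q E"
    and "\<And>v. v \<in> (\<Union>c<k. Q c) \<Longrightarrow> card {e \<in> E. v \<in> e} = q - 1"
    and "\<And>v. v \<in> (\<Union>c<k. Q c) \<Longrightarrow> card {u. {u, v} \<in> E} \<le> q - 1"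
proof -
  have Q: "finite (Q c) \<and> card (Q c) = q" if "c < k" for c using Qall that by simp
  have QQ: "Q c \<inter> Q d = {}" if "c < k" "d < k" "c \<noteq> d" for c d
    using disj that by (auto simp: disjoint_family_on_def)
  have fin: "finite (clique_edges (Q c))" if "c < k" for c
    using Q[OF that] by (auto simp: clique_edges_eq)
  have "card E = (\<Sum>c<k. card (clique_edges (Q c)))"
    unfolding E_def
  proof (rule card_UN_disjoint)
    show "\<forall>c\<in>{..<k}. \<forall>d\<in>{..<k}. c \<noteq> d \<longrightarrow> clique_edges (Q c) \<inter> clique_edges (Q d) = {}"
      by (intro ballI impI clique_edges_disjoint[of _ _ undefined]) (use QQ in auto)
  qed (use fin in auto)
  also have "\<dots> = (\<Sum>c<k. q choose 2)"
    by (rule sum.cong) (use Q in \<open>auto simp: clique_edges_eq n_subsets\<close>)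
  finally show "card E = k * (q choose 2)" by simp
  show "decomposable q E"
    unfolding E_def by (rule decomposable_cliques) (use Q QQ in auto)
  have at: "{e \<in> E. v \<in> e} = star v (Q c - {v})" if v: "v \<in> Q c" "c < k" for v c
  proof -
    have dc: "d = c" if "v \<in> Q d" "d < k" for d using QQ[of c d] v that by auto
    show ?thesis
    proof (intro set_eqI iffI)
      fix e assume "e \<in> {e \<in> E. v \<in> e}"
      then obtain d a b where d: "d < k" "e = {a, b}" "a \<in> Q d" "b \<in> Q d" "a \<noteq> b" "v \<in> {a, b}"
        by (auto simp: E_def clique_edges_def)
      then have "d = c" using dc by auto
      then have "\<exists>w\<in>Q c - {v}. e = {v, w}" using d by (cases "v = a") (auto simp: insert_commute)
      then show "e \<in> star v (Q c - {v})" by (auto simp: star_def)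
    next
      fix e assume "e \<in> star v (Q c - {v})"
      then obtain w where "e = {v, w}" "w \<in> Q c" "w \<noteq> v" by (auto simp: star_def)
      then show "e \<in> {e \<in> E. v \<in> e}" using v unfolding E_def clique_edges_def by blast
    qed
  qed
  show "card {e \<in> E. v \<in> e} = q - 1" if v: "v \<in> (\<Union>c<k. Q c)" for v
  proof -
    obtain c where c: "c < k" "v \<in> Q c" using v by auto
    have "inj_on (\<lambda>u. {v, u}) (Q c - {v})" by (auto simp: inj_on_def doubleton_eq_iff)
    then show ?thesis using at[OF c(2,1)] Q[OF c(1)] c by (simp add: star_def card_image)
  qed
  show "card {u. {u, v} \<in> E} \<le> q - 1" if v: "v \<in> (\<Union>c<k. Q c)" for v
  proof -
    obtain c where c: "c < k" "v \<in> Q c" using v by auto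
    have "{u. {u, v} \<in> E} \<subseteq> Q c - {v}"
    proof
      fix u assume "u \<in> {u. {u, v} \<in> E}"
      then obtain d where d: "d < k" "{u, v} \<in> clique_edges (Q d)" by (auto simp: E_def)
      then have "d = c" using clique_nbrs[OF d(2)] QQ[of c d] c by auto
      then show "u \<in> Q c - {v}" using clique_nbrs[OF d(2)] by simp
    qed
    then have "card {u. {u, v} \<in> E} \<le> card (Q c - {v})" by (rule card_mono[rotated]) (use Q c in auto)
    then show ?thesis using Q[OF c(1)] c by simp
  qed
qed

lemma petal_edgesE:
  assumes "e \<in> petal_edges n h s t B" and pet: "petals q n s t B"
  obtains i where "i < n" "e = {h, s i} \<or> e = {h, t i} \<or> e \<in> clique_edges (petal_verts s t B i)"
proof -
  obtain i where i: "i < n" and "e = {h, s i} \<or> e = {h, t i} \<or> e \<in> star (s i) (B i) \<or>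
      e \<in> clique_edges (insert (t i) (B i))"
    using assms(1) by (auto simp: petal_edges_def)
  moreover have "star (s i) (B i) \<subseteq> clique_edges (petal_verts s t B i)"
    using pet i by (auto simp: star_def clique_edges_eq petal_verts_def petals_def card_insert_if)
  moreover have "clique_edges (insert (t i) (B i)) \<subseteq> clique_edges (petal_verts s t B i)"
    by (auto simp: clique_edges_eq petal_verts_def)
  ultimately show ?thesis using that by blast
qed

lemma link_edgesE:
  assumes "e \<in> link_edges n x y s t B"
  obtains i b where "i < n" "b = s i \<and> e = {x i, b} \<or> b \<in> insert (t i) (B i) \<and> e = {y i, b}"
proof -
  obtain i where i: "i < n" and e: "e = {x i, s i} \<or> e \<in> star (y i) (insert (t i) (B i))"
    using assms by (auto simp: link_edges_def)
  from e show ?thesis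
  proof
    assume "e = {x i, s i}"
    then show ?thesis using that[OF i, of "s i"] by simp
  next
    assume "e \<in> star (y i) (insert (t i) (B i))"
    then obtain b where "b \<in> insert (t i) (B i)" "e = {y i, b}" by (auto simp: star_def)
    then show ?thesis using that[OF i, of b] by simp
  qed
qed

lemma link_edges_sub:
  assumes "e \<in> link_edges n x y s t B" "\<And>i. i < n \<Longrightarrow> x i \<in> V \<and> y i \<in> V"
  shows "\<exists>v\<in>V. \<exists>b\<in>(\<Union>i<n. petal_verts s t B i). e = {v, b}"
  using assms(1) by (rule link_edgesE) (use assms(2) in \<open>auto simp: petal_verts_def\<close>)

lemma petal_verts_unique:
  "petals q n s t B \<Longrightarrow> a \<in> petal_verts s t B i \<Longrightarrow> a \<in> petal_verts s t B j \<Longrightarrow> i < n \<Longrightarrow> j < n \<Longrightarrow> i = j"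
  unfolding petals_def disjoint_family_on_def by blast

lemma link_nbr:
  assumes e: "{u, z} \<in> link_edges n x y s t B" and pet: "petals q n s t B"
    and xy: "\<And>i. i < n \<Longrightarrow> x i \<in> V \<and> y i \<in> V"
    and P: "P = (\<Union>i<n. petal_verts s t B i)" "P \<inter> V = {}"
    and z: "z \<in> petal_verts s t B i" "i < n"
  shows "u = (if z = s i then x i else y i)"
  using e
proof (rule link_edgesE)
  fix j b assume j: "j < n" and b: "b = s j \<and> {u, z} = {x j, b} \<or> b \<in> insert (t j) (B j) \<and> {u, z} = {y j, b}"
  have bj: "b \<in> petal_verts s t B j" using b by (auto simp: petal_verts_def)
  have zV: "z \<notin> V" using z P by auto
  then have zb: "z = b" using b xy[OF j] by (auto simp: doubleton_eq_iff)
  then have "j = i" using petal_verts_unique[OF pet bj _ j z(2)] z(1) by simp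
  moreover have "s j \<notin> insert (t j) (B j)" using pet j by (auto simp: petals_def)
  ultimately show ?thesis using b zb zV xy[OF j] by (auto simp: doubleton_eq_iff)
qed

text \<open>A petal vertex has at most three earlier neighbours: the hub, and one end of a link on either side.
  Within its petal it has at most \<open>q - 1 \<le> 2 * q - 5\<close> neighbours.\<close>

lemma petals_attached:
  assumes q: "q \<ge> 4" and pet: "petals q n s t B" and P: "P = (\<Union>i<n. petal_verts s t B i)"
    and V: "finite V" "\<And>i. i < n \<Longrightarrow> x i \<in> V \<and> y i \<in> V"
    and V': "finite V'" "\<And>i. i < n \<Longrightarrow> x' i \<in> V' \<and> y' i \<in> V'"
    and disj: "(V \<union> insert h V') \<inter> P = {}"
  shows "attached q (V \<union> insert h V') P
     (petal_edges n h s t B \<union> link_edges n x y s t B \<union> link_edges n x' y' s t B)" (is "attached q ?W P ?T")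
  unfolding attached_def
proof (intro conjI ballI)
  have pc: "finite (petal_verts s t B i)" "card (petal_verts s t B i) = q" if "i < n" for i
    using pet that q by (auto simp: petals_def petal_verts_def)
  show "finite P" using pc P by auto
  show "?W \<inter> P = {}" by (rule disj)
  have "e \<subseteq> ?W \<union> P \<and> card e = 2 \<and> \<not> e \<subseteq> ?W" if eT: "e \<in> ?T" for e
  proof -
    consider "e \<in> petal_edges n h s t B" | "e \<in> link_edges n x y s t B" | "e \<in> link_edges n x' y' s t B"
      using eT by blast
    then show ?thesis
    proof cases
      case 1
      then obtain i where i: "i < n" "e = {h, s i} \<or> e = {h, t i} \<or> e \<in> clique_edges (petal_verts s t B i)"
        by (rule petal_edgesE[OF _ pet])
      have st: "s i \<in> P" "t i \<in> P" "petal_verts s t B i \<subseteq> P"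
        using i(1) P by (auto simp: petal_verts_def)
      have "h \<noteq> s i" "h \<noteq> t i" using st disj by auto
      moreover have "e \<subseteq> P \<and> card e = 2 \<and> \<not> e \<subseteq> ?W" if "e \<in> clique_edges (petal_verts s t B i)"
      proof -
        have "e \<subseteq> P" "card e = 2" using that st by (auto simp: clique_edges_eq)
        moreover have "e \<noteq> {}" using \<open>card e = 2\<close> by auto
        ultimately show ?thesis using disj by blast
      qed
      ultimately show ?thesis using i(2) st disj by auto
    next
      case 2
      then obtain v b where "v \<in> V" "b \<in> P" "e = {v, b}" using link_edges_sub[OF 2 V(2)] P by blast
      moreover from this have "v \<noteq> b" using disj by auto
      ultimately show ?thesis using disj by auto
    next
      case 3
      then obtain v b where "v \<in> V'" "b \<in> P" "e = {v, b}" using link_edges_sub[OF 3 V'(2)] P by blast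
      moreover from this have "v \<noteq> b" using disj by auto
      ultimately show ?thesis using disj by auto
    qed
  qed
  then show "e \<subseteq> ?W \<union> P" "card e = 2" "\<not> e \<subseteq> ?W" if "e \<in> ?T" for e using that by auto
  fix z assume "z \<in> P"
  then obtain i where i: "i < n" "z \<in> petal_verts s t B i" using P by auto
  have zW: "z \<notin> ?W" using \<open>z \<in> P\<close> disj by auto
  have nb: "u \<in> {h, if z = s i then x i else y i, if z = s i then x' i else y' i} \<or>
      u \<in> petal_verts s t B i - {z}" if uz: "{u, z} \<in> ?T" for u
  proof -
    consider "{u, z} \<in> petal_edges n h s t B" | "{u, z} \<in> link_edges n x y s t B" | "{u, z} \<in> link_edges n x' y' s t B"
      using uz by blast
    then show ?thesis
    proof cases
      case 1
      then obtain j where j: "j < n" "{u, z} = {h, s j} \<or> {u, z} = {h, t j} \<or>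
          {u, z} \<in> clique_edges (petal_verts s t B j)"
        by (rule petal_edgesE[OF _ pet])
      show ?thesis
      proof (cases "{u, z} \<in> clique_edges (petal_verts s t B j)")
        case True
        have "j = i" using clique_nbrs[OF True] petal_verts_unique[OF pet _ i(2) j(1) i(1)] by simp
        then show ?thesis using clique_nbrs[OF True] by simp
      next
        case False
        then have "u = h" using j(2) zW by (auto simp: doubleton_eq_iff)
        then show ?thesis by simp
      qed
    next
      case 2
      have "P \<inter> V = {}" using disj by auto
      from link_nbr[OF 2 pet V(2) P this i(2,1)] show ?thesis by simp
    next
      case 3
      have "P \<inter> V' = {}" using disj by auto
      from link_nbr[OF 3 pet V'(2) P this i(2,1)] show ?thesis by simp
    qed
  qed
  have pP: "petal_verts s t B i \<subseteq> P" using P i by auto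
  have "{u \<in> ?W. {u, z} \<in> ?T} \<subseteq> {h, if z = s i then x i else y i, if z = s i then x' i else y' i}"
    using nb pP disj by blast
  then have "card {u \<in> ?W. {u, z} \<in> ?T} \<le> card {h, if z = s i then x i else y i, if z = s i then x' i else y' i}"
    by (rule card_mono[rotated]) simp
  also have "\<dots> \<le> 3" by (simp add: card_insert_if)
  finally show "card {u \<in> ?W. {u, z} \<in> ?T} \<le> 3" .
  have W': "h \<notin> P" "x i \<notin> P" "y i \<notin> P" "x' i \<notin> P" "y' i \<notin> P"
    using V(2)[OF i(1)] V'(2)[OF i(1)] disj by auto
  have "{u \<in> P. {u, z} \<in> ?T} \<subseteq> petal_verts s t B i - {z}"
  proof
    fix u assume "u \<in> {u \<in> P. {u, z} \<in> ?T}"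
    then show "u \<in> petal_verts s t B i - {z}" using nb[of u] W' by (auto split: if_splits)
  qed
  then have "card {u \<in> P. {u, z} \<in> ?T} \<le> card (petal_verts s t B i - {z})"
    by (rule card_mono[rotated]) (use pc i in auto)
  also have "\<dots> = q - 1" using pc[OF i(1)] i(2) by simp
  also have "\<dots> \<le> 2 * q - 5" using q by simp
  finally show "card {u \<in> P. {u, z} \<in> ?T} \<le> 2 * q - 5" .
qed

lemma sparse_root: "finite R \<Longrightarrow> sparse q R R {}"
proof -
  have "4 * q \<le> (2 * q + 1) * m" if "m \<ge> 2" for m :: nat
    using mult_le_mono2[OF that, of "2 * q + 1"] by simp
  then show "finite R \<Longrightarrow> sparse q R R {}" by (simp add: sparse_def)
qed

lemma fresh_skeleton:
  fixes V :: "nat set"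
  assumes V: "finite V" and q: "q \<ge> 4" and k: "k \<le> n"
  obtains h Q s t B where "petals q n s t B" "\<And>c. c < k \<Longrightarrow> finite (Q c) \<and> card (Q c) = q"
    "disjoint_family_on Q {..<k}" "h \<notin> V" "h \<notin> (\<Union>c<k. Q c)" "(\<Union>c<k. Q c) \<inter> V = {}"
    "(\<Union>i<n. petal_verts s t B i) \<inter> (V \<union> insert h (\<Union>c<k. Q c)) = {}"
proof -
  define I where "I = {..<3::nat} \<times> {..<Suc n} \<times> {..<q}"
  have "finite I" by (simp add: I_def)
  then obtain f :: "nat \<times> nat \<times> nat \<Rightarrow> nat" where f: "inj_on f I" "f ` I \<inter> V = {}"
    using ex_fresh_inj[OF V, of I] by auto
  have eq: "f (a, b, c) = f (a', b', c') \<longleftrightarrow> a = a' \<and> b = b' \<and> c = c'"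
    if "(a, b, c) \<in> I" "(a', b', c') \<in> I" for a b c a' b' c'
    using inj_on_eq_iff[OF f(1) that] by simp
  have V': "f (a, b, c) \<notin> V" if "(a, b, c) \<in> I" for a b c using f(2) that by blast
  define h where "h = f (0, 0, 0)"
  define Q where "Q c = (\<lambda>j. f (1, c, j)) ` {..<q}" for c
  define s where "s i = f (2, i, 0)" for i
  define t where "t i = f (2, i, 1)" for i
  define B where "B i = (\<lambda>j. f (2, i, j)) ` {2..<q}" for i
  have pv: "petal_verts s t B i = (\<lambda>j. f (2, i, j)) ` {..<q}" for i
  proof -
    have "{..<q} = insert 0 (insert 1 {2..<q})" using q by auto
    then show ?thesis by (simp add: petal_verts_def s_def t_def B_def)
  qed
  have memI: "(0, 0, 0) \<in> I" "\<And>c j. c < k \<Longrightarrow> j < q \<Longrightarrow> (1, c, j) \<in> I"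
    "\<And>i j. i < n \<Longrightarrow> j < q \<Longrightarrow> (2, i, j) \<in> I"
    using q k by (auto simp: I_def)
  show ?thesis
  proof (rule that)
    show "petals q n s t B"
      unfolding petals_def
    proof (intro conjI allI impI)
      fix i assume i: "i < n"
      have j: "f (2, i, j) = f (2, i, j') \<longleftrightarrow> j = j'" if "j < q" "j' < q" for j j'
        using eq[OF memI(3)[OF i that(1)] memI(3)[OF i that(2)]] by simp
      show "s i \<noteq> t i" "s i \<notin> B i" "t i \<notin> B i" "finite (B i)"
        using j q by (auto simp: s_def t_def B_def)
      have "inj_on (\<lambda>j. f (2, i, j)) {2..<q}" using j by (auto simp: inj_on_def)
      then show "card (B i) = q - 2" by (simp add: B_def card_image)
    next
      show "disjoint_family_on (petal_verts s t B) {..<n}"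
        unfolding disjoint_family_on_def pv using eq memI(3) by auto
    qed
    show "finite (Q c) \<and> card (Q c) = q" if c: "c < k" for c
    proof -
      have "inj_on (\<lambda>j. f (1, c, j)) {..<q}" using eq memI(2)[OF c] by (auto simp: inj_on_def)
      then show ?thesis by (simp add: Q_def card_image)
    qed
    show "disjoint_family_on Q {..<k}"
      unfolding disjoint_family_on_def Q_def using eq memI(2) by auto
    show "h \<notin> V" unfolding h_def using V'[OF memI(1)] .
    show "h \<notin> (\<Union>c<k. Q c)" using eq[OF memI(1) memI(2)] by (auto simp: h_def Q_def)
    show "(\<Union>c<k. Q c) \<inter> V = {}" using V'[OF memI(2)] by (auto simp: Q_def)
    show "(\<Union>i<n. petal_verts s t B i) \<inter> (V \<union> insert h (\<Union>c<k. Q c)) = {}"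
      unfolding pv using V'[OF memI(3)] eq[OF memI(1) memI(3)] eq[OF memI(3) memI(2)]
      by (auto simp: h_def Q_def)
  qed
qed

section \<open>Absorbers of bounded size and density\<close>

text \<open>For a graph on at most \<open>C\<close> vertices, \<open>2 ^ C\<close> bounds the number of edges, hence the number of petals
  and of disjoint cliques, each of which has \<open>q\<close> vertices.\<close>

definition skeleton_bound :: "nat \<Rightarrow> nat \<Rightarrow> nat" where
  "skeleton_bound q C = C + 1 + 2 ^ C * q + 2 ^ C * q"

definition absorber_bound :: "nat \<Rightarrow> nat \<Rightarrow> nat" where
  "absorber_bound q C = skeleton_bound q C + 2 * move_bound q (skeleton_bound q C)"

text \<open>With \<open>E'\<close> the \<open>k\<close> disjoint cliques, \<open>F\<close> the petals, \<open>J\<close> and \<open>J'\<close> the links of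
  \<open>L\<close> and of \<open>E'\<close>, and \<open>T\<close> and \<open>T'\<close> the two families of grids, the absorber is
  \<open>(F \<union> J \<union> T) \<union> (E' \<union> J' \<union> T')\<close>, and with \<open>L\<close> added it regroups as
  \<open>(L \<union> J \<union> T) \<union> (F \<union> J' \<union> T') \<union> E'\<close>.  The parts in brackets are decomposable by
  \<open>petal_transformer\<close>.  The degrees in \<open>E'\<close> are \<open>q - 1\<close>, so that lemma applies to \<open>E'\<close> just as to
  \<open>L\<close>.\<close>

lemma absorber_exists:
  fixes L :: "nat graph"
  assumes q: "q \<ge> 4" and L: "simple_graph L" and div: "clique_divisible q L"
    and C: "card (verts L) \<le> C"
  shows "\<exists>A. clique_absorber q L A \<and> card (verts A) \<le> absorber_bound q C \<and>
    rooted_two_density A (verts L) \<le> real q + 1 / 2"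
proof -
  define V where "V = verts L"
  have finV: "finite V" and EL: "\<And>e. e \<in> edges L \<Longrightarrow> e \<subseteq> V \<and> card e = 2"
    using L by (auto simp: simple_graph_def V_def)
  have finE: "finite (edges L)" by (rule finite_subset[of _ "Pow V"]) (use EL finV in auto)
  define n where "n = card (edges L)"
  obtain x y where xy: "inj_on (\<lambda>i. {x i, y i}) {..<n}" "(\<lambda>i. {x i, y i}) ` {..<n} = edges L"
    "\<And>i. i < n \<Longrightarrow> x i \<noteq> y i"
    using enumerate_edges[OF finE] EL unfolding n_def by blast
  have xyV: "x i \<in> V \<and> y i \<in> V" if "i < n" for i using xy(2) EL that by blast
  obtain k where k: "n = k * (q choose 2)"
    using div unfolding clique_divisible_def n_def by (metis dvd_def mult.commute)
  have "q choose 2 > 0" using q by (simp add: zero_less_binomial)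
  then have "k * 1 \<le> k * (q choose 2)" by (intro mult_le_mono2) linarith
  then have kn: "k \<le> n" unfolding k by simp
  obtain h Q s t B where pet: "petals q n s t B" and Q: "\<And>c. c < k \<Longrightarrow> finite (Q c) \<and> card (Q c) = q"
    "disjoint_family_on Q {..<k}" and hV: "h \<notin> V" "h \<notin> (\<Union>c<k. Q c)" and QV: "(\<Union>c<k. Q c) \<inter> V = {}"
    and PV: "(\<Union>i<n. petal_verts s t B i) \<inter> (V \<union> insert h (\<Union>c<k. Q c)) = {}"
    using fresh_skeleton[OF finV q kn] by metis
  define V' where "V' = (\<Union>c<k. Q c)"
  define P where "P = (\<Union>i<n. petal_verts s t B i)"
  define E' where "E' = (\<Union>c<k. clique_edges (Q c))"
  have q0: "q > 0" using q by simp
  have "\<forall>c<k. finite (Q c) \<and> card (Q c) = q" using Q(1) by blast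
  note E'cl = disjoint_cliques[OF this Q(2) q0, folded E'_def V'_def]
  have E': "e \<subseteq> V' \<and> card e = 2" if "e \<in> E'" for e
    using that by (auto simp: E'_def V'_def clique_edges_eq)
  have finV': "finite V'" using Q by (auto simp: V'_def)
  have finE': "finite E'" by (rule finite_subset[of _ "Pow V'"]) (use E' finV' in auto)
  have cE': "card E' = n" using E'cl(1) by (simp add: k)
  have cards: "\<And>e. e \<in> E' \<Longrightarrow> card e = 2" using E' by blast
  obtain x' y' where xy': "inj_on (\<lambda>i. {x' i, y' i}) {..<n}" "(\<lambda>i. {x' i, y' i}) ` {..<n} = E'"
    "\<And>i. i < n \<Longrightarrow> x' i \<noteq> y' i"
  proof (rule enumerate_edges[OF finE' cards, unfolded cE'])
    fix x y assume "inj_on (\<lambda>i. {x i, y i}) {..<n}" "(\<lambda>i. {x i, y i}) ` {..<n} = E'"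
      "\<And>i. i < n \<Longrightarrow> x i \<noteq> y i"
    then show thesis by (rule that)
  qed
  have xyV': "x' i \<in> V' \<and> y' i \<in> V'" if "i < n" for i using xy'(2) E' that by blast
  have deg: "(q - 1) dvd card {i. i < n \<and> x i = v} + card {i. i < n \<and> y i = v}" if "v \<in> V" for v
  proof -
    have "card {e \<in> edges L. v \<in> e} = card {i. i < n \<and> x i = v} + card {i. i < n \<and> y i = v}"
      using degree_enumerated[OF xy(1,3)] unfolding xy(2) by simp
    then show ?thesis using div that unfolding clique_divisible_def degree_def V_def by metis
  qed
  have deg': "(q - 1) dvd card {i. i < n \<and> x' i = v} + card {i. i < n \<and> y' i = v}" if "v \<in> V'" for v
  proof -
    have "card {e \<in> E'. v \<in> e} = card {i. i < n \<and> x' i = v} + card {i. i < n \<and> y' i = v}"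
      using degree_enumerated[OF xy'(1,3)] unfolding xy'(2) by simp
    then show ?thesis using E'cl(3)[OF that] by (metis dvd_refl)
  qed
  define W where "W = V \<union> insert h V'"
  have WP: "W \<inter> P = {}" using PV by (auto simp: W_def V'_def P_def)
  have finP: "finite P" using pet by (auto simp: P_def petal_verts_def petals_def)
  define X where "X = W \<union> P"
  have finX: "finite X" using finV finV' finP by (auto simp: X_def W_def)
  define F where "F = petal_edges n h s t B"
  define J where "J = link_edges n x y s t B"
  define J' where "J' = link_edges n x' y' s t B"
  obtain Z T where T: "attached q X Z T"
    "card Z \<le> move_bound q (card (insert h V \<union> P))"
    "decomposable q (edges L \<union> J \<union> T)" "decomposable q (F \<union> J \<union> T)"
  proof -
    have PV': "P \<inter> insert h V = {}" "insert h V \<union> P \<subseteq> X" using WP by (auto simp: X_def W_def)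
    have ends: "x i \<in> V \<and> y i \<in> V \<and> x i \<noteq> y i" if "i < n" for i using xyV[OF that] xy(3)[OF that] by blast
    show thesis
    proof (rule petal_transformer[OF P_def q finV pet ends xy(1) deg hV(1) PV'(1) finX PV'(2)])
      fix Z T
      assume "attached q X Z T"
        "card Z \<le> move_bound q (card (insert h V \<union> P))"
        "decomposable q ((\<lambda>i. {x i, y i}) ` {..<n} \<union> link_edges n x y s t B \<union> T)"
        "decomposable q (petal_edges n h s t B \<union> link_edges n x y s t B \<union> T)"
      then show thesis unfolding xy(2) F_def[symmetric] J_def[symmetric] by (rule that)
    qed
  qed
  have finZ: "finite Z" using T(1) by (simp add: attached_def)
  obtain Z' T' where T': "attached q (X \<union> Z) Z' T'"
    "card Z' \<le> move_bound q (card (insert h V' \<union> P))"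
    "decomposable q (E' \<union> J' \<union> T')" "decomposable q (F \<union> J' \<union> T')"
  proof -
    have PV': "P \<inter> insert h V' = {}" "finite (X \<union> Z)" "insert h V' \<union> P \<subseteq> X \<union> Z"
      using WP finX finZ by (auto simp: X_def W_def)
    have ends: "x' i \<in> V' \<and> y' i \<in> V' \<and> x' i \<noteq> y' i" if "i < n" for i
      using xyV'[OF that] xy'(3)[OF that] by blast
    show thesis
    proof (rule petal_transformer[OF P_def q finV' pet ends xy'(1) deg' hV(2)[folded V'_def] PV'])
      fix Z' T'
      assume "attached q (X \<union> Z) Z' T'"
        "card Z' \<le> move_bound q (card (insert h V' \<union> P))"
        "decomposable q ((\<lambda>i. {x' i, y' i}) ` {..<n} \<union> link_edges n x' y' s t B \<union> T')"
        "decomposable q (petal_edges n h s t B \<union> link_edges n x' y' s t B \<union> T')"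
      then show thesis unfolding xy'(2) F_def[symmetric] J'_def[symmetric] by (rule that)
    qed
  qed
  have VV': "V \<inter> insert h V' = {}" using hV(1) QV by (auto simp: V'_def)
  have att1: "attached q V (insert h V') E'"
    unfolding attached_def
  proof (intro conjI ballI)
    fix e assume e: "e \<in> E'"
    show "e \<subseteq> V \<union> insert h V'" "card e = 2" using E'[OF e] by auto
    have "e \<noteq> {}" using E'[OF e] by auto
    then show "\<not> e \<subseteq> V" using E'[OF e] VV' by blast
  next
    fix z assume z: "z \<in> insert h V'"
    have "{u \<in> V. {u, z} \<in> E'} = {}" using E' VV' by blast
    then show "card {u \<in> V. {u, z} \<in> E'} \<le> 3" by (simp only: card.empty)
    show "card {u \<in> insert h V'. {u, z} \<in> E'} \<le> 2 * q - 5"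
    proof (cases "z \<in> V'")
      case True
      have "{u. {u, z} \<in> E'} \<subseteq> V'" using E' by blast
      then have "card {u \<in> insert h V'. {u, z} \<in> E'} \<le> card {u. {u, z} \<in> E'}"
        by (intro card_mono) (use finV' finite_subset in auto)
      then show ?thesis using E'cl(4)[OF True] q by linarith
    next
      case False
      then have "{u \<in> insert h V'. {u, z} \<in> E'} = {}" using E' by blast
      then show ?thesis by (simp only: card.empty)
    qed
  qed (use finV' VV' in auto)
  have att2: "attached q W P (F \<union> J \<union> J')"
    unfolding W_def F_def J_def J'_def
    by (rule petals_attached[OF q pet P_def finV xyV finV' xyV']) (use WP in \<open>auto simp: W_def\<close>)
  define A :: "nat graph" where
    "A = \<lparr>verts = X \<union> Z \<union> Z', edges = E' \<union> (F \<union> J \<union> J') \<union> T \<union> T'\<rparr>"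
  have VW: "V \<subseteq> W" "V \<subseteq> X" "V \<subseteq> X \<union> Z" by (auto simp: W_def X_def)
  have "sparse q V W ({} \<union> E')"
    unfolding W_def by (rule sparse_attach[OF sparse_root[OF finV] att1 _ q]) simp
  then have "sparse q V X ({} \<union> E' \<union> (F \<union> J \<union> J'))"
    unfolding X_def by (rule sparse_attach[OF _ att2 VW(1) q])
  then have "sparse q V (X \<union> Z) ({} \<union> E' \<union> (F \<union> J \<union> J') \<union> T)"
    by (rule sparse_attach[OF _ T(1) VW(2) q])
  then have "sparse q V (X \<union> Z \<union> Z') ({} \<union> E' \<union> (F \<union> J \<union> J') \<union> T \<union> T')"
    by (rule sparse_attach[OF _ T'(1) VW(3) q])
  then have spA: "sparse q V (verts A) (edges A)" by (simp add: A_def)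
  then have simpA: "simple_graph A" by (auto simp: sparse_def simple_graph_def)
  \<comment> \<open>the layer of the latest vertex of an edge tells in which step the edge was added\<close>
  have new1: "e \<subseteq> V' \<and> \<not> e \<subseteq> V" if "e \<in> E'" for e using E' att1 that by (auto simp: attached_def)
  have new2: "e \<subseteq> X \<and> \<not> e \<subseteq> W" if "e \<in> F \<union> J \<union> J'" for e
    using att2 that unfolding attached_def X_def by blast
  have new3: "e \<subseteq> X \<union> Z \<and> \<not> e \<subseteq> X" if "e \<in> T" for e using T(1) that unfolding attached_def by blast
  have new4: "\<not> e \<subseteq> X \<union> Z" if "e \<in> T'" for e using T'(1) that unfolding attached_def by blast
  have F: "e \<inter> V = {} \<and> e \<inter> V' = {}" if eF: "e \<in> F" for e
  proof -
    obtain i where i: "i < n" "e = {h, s i} \<or> e = {h, t i} \<or> e \<in> clique_edges (petal_verts s t B i)"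
      using petal_edgesE[OF eF[unfolded F_def] pet] by metis
    then have "e \<subseteq> insert h P" by (auto simp: P_def petal_verts_def clique_edges_eq)
    moreover have "insert h P \<inter> V = {}" "insert h P \<inter> V' = {}"
      using WP hV by (auto simp: W_def V'_def)
    ultimately show ?thesis by blast
  qed
  have J: "e \<inter> V \<noteq> {} \<and> e \<inter> V' = {}" if eJ: "e \<in> J" for e
  proof -
    obtain v b where "v \<in> V" "b \<in> P" "e = {v, b}"
      using link_edges_sub[OF eJ[unfolded J_def] xyV] P_def by metis
    then show ?thesis using WP VV' by (auto simp: W_def)
  qed
  have J': "e \<inter> V = {} \<and> e \<inter> V' \<noteq> {}" if eJ: "e \<in> J'" for e
  proof -
    obtain v b where "v \<in> V'" "b \<in> P" "e = {v, b}"
      using link_edges_sub[OF eJ[unfolded J'_def] xyV'] P_def by metis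
    then show ?thesis using WP VV' by (auto simp: W_def)
  qed
  have V'W: "V' \<subseteq> W" "W \<subseteq> X" "V' \<subseteq> X" by (auto simp: W_def X_def)
  have "independent_set A V"
    unfolding independent_set_def
  proof (intro conjI ballI)
    show "V \<subseteq> verts A" by (auto simp: A_def X_def W_def)
    fix u v assume "u \<in> V" "v \<in> V"
    then have "{u, v} \<subseteq> V" by simp
    then have "{u, v} \<notin> E'" "{u, v} \<notin> F \<union> J \<union> J'" "{u, v} \<notin> T" "{u, v} \<notin> T'"
      using new1 new2 new3 new4 VW by (meson subset_trans)+
    then show "{u, v} \<notin> edges A" by (simp add: A_def)
  qed
  moreover have "\<exists>D. clique_decomposition q A D"
  proof (rule clique_decomposition_exists[OF _ simpA])
    have "e \<notin> E' \<union> J' \<union> T'" if "e \<in> F \<union> J \<union> T" for e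
    proof -
      have "e \<notin> E'" using that new1[of e] new2[of e] new3[of e] V'W by blast
      moreover have "e \<notin> J'" using that F[of e] J[of e] J'[of e] new2[of e] new3[of e] by blast
      moreover have "e \<notin> T'" using that new4[of e] new2[of e] new3[of e] by blast
      ultimately show ?thesis by blast
    qed
    then have "decomposable q ((F \<union> J \<union> T) \<union> (E' \<union> J' \<union> T'))"
      by (intro decomposable_Un T(4) T'(3)) auto
    moreover have "edges A = (F \<union> J \<union> T) \<union> (E' \<union> J' \<union> T')" by (auto simp: A_def)
    ultimately show "decomposable q (edges A)" by simp
  qed (use q in simp)
  moreover have "\<exists>D. clique_decomposition q (graph_union L A) D"
  proof (rule clique_decomposition_exists)
    show "simple_graph (graph_union L A)"
      using L simpA by (auto simp: simple_graph_def graph_union_def)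
    have LV: "e \<subseteq> V" "e \<noteq> {}" if "e \<in> edges L" for e using EL[OF that] by auto
    have "e \<notin> F \<union> J' \<union> T'" if "e \<in> edges L \<union> J \<union> T" for e
    proof -
      have "e \<notin> F \<union> J'"
        using that LV[of e] F[of e] J[of e] J'[of e] new2[of e] new3[of e] by blast
      moreover have "e \<notin> T'" using that LV[of e] VW new4[of e] new2[of e] new3[of e] by blast
      ultimately show ?thesis by blast
    qed
    then have 1: "decomposable q ((edges L \<union> J \<union> T) \<union> (F \<union> J' \<union> T'))"
      by (intro decomposable_Un T(3) T'(4)) auto
    have "e \<notin> (edges L \<union> J \<union> T) \<union> (F \<union> J' \<union> T')" if "e \<in> E'" for e
    proof -
      have "e \<notin> edges L" using LV(1)[of e] new1[OF that] by blast
      moreover have "e \<subseteq> W" "e \<subseteq> X" using new1[OF that] V'W by blast+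
      ultimately show ?thesis using new2[of e] new3[of e] new4[of e] by blast
    qed
    moreover have "decomposable q E'" by (rule E'cl(2))
    ultimately have "decomposable q (((edges L \<union> J \<union> T) \<union> (F \<union> J' \<union> T')) \<union> E')"
      by (intro decomposable_Un 1) auto
    moreover have "edges (graph_union L A) = ((edges L \<union> J \<union> T) \<union> (F \<union> J' \<union> T')) \<union> E'"
      by (auto simp: A_def graph_union_def)
    ultimately show "decomposable q (edges (graph_union L A))" by simp
  qed (use q in simp)
  ultimately have "clique_absorber q L A" using simpA by (simp add: clique_absorber_def V_def)
  moreover have "rooted_two_density A (verts L) \<le> real q + 1 / 2"
    using sparse_rooted_two_density[OF spA q] by (simp add: V_def)
  moreover have "card (verts A) \<le> absorber_bound q C"
  proof -
    have "n \<le> card (Pow V)" unfolding n_def by (rule card_mono) (use finV EL in auto)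
    also have "\<dots> = 2 ^ card V" by (rule card_Pow[OF finV])
    also have "\<dots> \<le> 2 ^ C" using C by (simp add: V_def)
    finally have n2: "n \<le> 2 ^ C" .
    have pc: "card (petal_verts s t B i) = q" if "i < n" for i
      using pet that q by (auto simp: petals_def petal_verts_def)
    have "card P \<le> (\<Sum>i<n. card (petal_verts s t B i))" unfolding P_def by (rule card_UN_le) simp
    also have "\<dots> = n * q" using pc by simp
    also have "\<dots> \<le> 2 ^ C * q" using n2 by simp
    finally have cP: "card P \<le> 2 ^ C * q" .
    have "card V' \<le> (\<Sum>c<k. card (Q c))" unfolding V'_def by (rule card_UN_le) simp
    also have "\<dots> = k * q" using Q by simp
    also have "\<dots> \<le> 2 ^ C * q" using n2 kn by simp
    finally have cV': "card V' \<le> 2 ^ C * q" .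
    have "card W \<le> card V + card (insert h V')" unfolding W_def by (rule card_Un_le)
    also have "\<dots> \<le> C + (1 + 2 ^ C * q)"
      using C cV' finV' by (intro add_mono) (auto simp: V_def card_insert_if)
    finally have "card W \<le> C + (1 + 2 ^ C * q)" .
    then have cX: "card X \<le> skeleton_bound q C"
      using card_Un_le[of W P] cP unfolding X_def skeleton_bound_def by linarith
    have "card (insert h V \<union> P) \<le> card X" "card (insert h V' \<union> P) \<le> card X"
      by (intro card_mono finX; auto simp: X_def W_def)+
    then have "card Z \<le> move_bound q (skeleton_bound q C)" "card Z' \<le> move_bound q (skeleton_bound q C)"
      using T(2) T'(2) cX move_bound_mono by (meson le_trans)+
    then show ?thesis
      using card_Un_le[of "X \<union> Z" Z'] card_Un_le[of X Z] cX
      unfolding A_def absorber_bound_def by simp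
  qed
  ultimately show ?thesis by blast
qed

theorem theorem1p15:
  fixes q :: nat
  assumes "q \<ge> 4"
  shows "d_abs q \<le> ereal (real q + 1 / 2)"
proof -
  have "\<exists>C2::nat. C2 > 0 \<and> (\<forall>L :: nat graph.
      simple_graph L \<and> clique_divisible q L \<and> card (verts L) \<le> C1 \<longrightarrow>
      (\<exists>A :: nat graph. clique_absorber q L A \<and> card (verts A) \<le> C2 \<and>
         rooted_two_density A (verts L) \<le> real q + 1 / 2))" for C1
    using absorber_exists[OF assms, of _ C1]
    by (intro exI[of _ "absorber_bound q C1"])
      (auto simp: absorber_bound_def skeleton_bound_def)
  moreover have "real q + 1 / 2 > 0" by simp
  ultimately show ?thesis
    unfolding d_abs_def by (intro Inf_lower CollectI exI[of _ "real q + 1 / 2"]) blast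
qed

end
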